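(* Consider the tripartite signature protocol between Alice, Bob and Charlie described in the context, with $n$ (even) key blocks per receiver, error tolerance $e_{max}$ for Charlie, documents of $b_M$ bits, $b_H$-bit hashes and $b'_H$-bit authentication tags. If $b_M+4nb_H>(n/2)\log_2 n$, then the protocol is $\varepsilon_{\rm rep}$-secure against repudiation attacks with $$\varepsilon_{\rm rep}=\max\left\{\prod_{i=0}^{e_{max}}\frac{n/2-i}{n-i},\ \frac{b_M+4nb_H}{2^{b'_H-1}}\right\},$$ i.e. the probability that the protocol does not abort and that Charlie rejects a document-signature pair accepted by Bob is at most $\varepsilon_{\rm rep}$.
   Context: **LFSR hash family $\mathcal{F}_{\rm AXU}$.** For a $b_H$-bit string $p=(p_{b_H-1},\dots,p_0)$, let $p(x)=x^{b_H}+p_{b_H-1}x^{b_H-1}+\dots+p_1x+p_0$ over GF(2). Given an initial state $s=(s_{b_H-1},\dots,s_0)$, $s\ne0$, the linear feedback shift register (LFSR) with connection polynomial $p(x)$ generates bits $s_l=\sum_{i=0}^{b_H-1}p_i s_{l-b_H+i} \bmod 2$ for $l\ge b_H$, and its $k$-th state is $s^k=(s_{b_H-1+k},\dots,s_k)^T$. For $p(x)$ irreducible, $T_{p,s}$ is the $b_H\times b_M$ Toeplitz matrix with columns $(s^0,\dots,s^{b_M-1})$, and the hash of a $b_M$-bit message $m$ is $T_{p,s}\cdot m\bmod 2$. The family of these functions satisfies $\Pr[f(m_1)\oplus f(m_2)=b]\le b_M2^{1-b_H}$ for all $m_1\neq m_2$ and all $b$, for $f$ uniformly random in the family. **Authenticated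 channel.** It is reliable (no message is lost) and implemented by Wegman–Carter authentication with key recycling: the two users share a secret random function $f$ of the family $\mathcal{F}_{\rm AXU}$ with $b'_H$-bit outputs, and each message $m$ is sent with tag $f(m)\oplus k$, with $k$ a fresh secret uniformly random $b'_H$-bit string. A modification of a $b$-bit message is accepted as authentic with probability at most $b/2^{b'_H-1}$. Failure to authenticate any message aborts the protocol (this is not the same as rejecting the signature). **Protocol.** 1. Distribution. (1.1) Alice shares with Bob (Charlie) a perfectly secret uniformly random key $X_B=X_B^1\|\dots\|X_B^n$ ($X_C=X_C^1\|\dots\|X_C^n$) of $n$ blocks of $3b_H$ bits; each block is $X_B^j=s_B^j\|r_B^j$ ($X_C^j=s_C^j\|r_C^j$) with $s^j$ of $b_H$ bits and $r^j$ of $2b_H$ bits. (1.2) Bob (Charlie) picks a random permutation $\gamma_B$ ($\gamma_C$) of $\{1,\dots,n\}$. (1.3) Over an authenticated secret channel, Bob sends Charlie the blocks $X_B^{\gamma_B(1)},\dots,X_B^{\gamma_B(n/2)}$ and (as a separate message of $(n/2)\log_2 n$ bits) the positions $\gamma_B(1),\dots,\gamma_B(n/2)$; likewise Charlie sends Bob $X_C^{\gamma_C(1)},\dots,X_C^{\gamma_C(n/2)}$ and the positions $\gamma_C(1),\dots,\gamma_C(n/2)$. 2. Messaging. (2.1)–(2.2) For each $j=1,\dots,n$ Alice picks random $b_H$-bit strings $p_B^j,p_C^j$ with irreducible associated polynomials and sets $Sig_j=(T_{p_B^j,s_B^j}\cdot Doc\,\|\,p_B^j)\oplus r_B^j$ and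 $Sig_{n+j}=(T_{p_C^j,s_C^j}\cdot Doc\,\|\,p_C^j)\oplus r_C^j$. She sends $\{Doc,Sig\}$, $Sig=Sig_1\|\dots\|Sig_{2n}$, to Bob over a public channel. (2.3) Bob checks the $3n/2$ signatures for which he holds the key block ($Sig_1,\dots,Sig_n$ and $Sig_{n+\gamma_C(1)},\dots,Sig_{n+\gamma_C(n/2)}$): each is decrypted with the corresponding $r$ to $(h'\|p')$ and he checks $h'=T_{p',s}\cdot Doc$ with the corresponding $s$. If any check fails he rejects and sends $\perp$ to Charlie; otherwise he accepts and forwards $\{Doc,Sig\}$ to Charlie over an authenticated channel. (2.4) Charlie checks in the same way $Sig_{n+1},\dots,Sig_{2n}$ and $Sig_{\gamma_B(1)},\dots,Sig_{\gamma_B(n/2)}$; he rejects if there are more than $e_{max}$ mismatches among these $3n/2$ checks, and accepts otherwise. **Repudiation attack.** Bob and Charlie are honest; Alice is malicious and computationally unbounded. She may send an arbitrary pair to Bob and may attempt to tamper with messages on the authenticated channel between Bob and Charlie. *)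

theory Defs
  imports "HOL-Probability.Probability" "HOL-Library.Z2" "HOL-Combinatorics.Permutations"
    "HOL-Computational_Algebra.Polynomial"
begin

section \<open>Bit strings\<close>

text \<open>
  A string \<open>(a\<^sub>b\<^sub>-\<^sub>1, \<dots>, a\<^sub>0)\<close> is the list of its bits as written, so \<open>a\<^sub>i\<close> is \<open>rev a ! i\<close>.
  The entries of messages and column vectors are counted from the left, starting from 0.
\<close>

type_synonym bits = "bit list"

definition xor_bits :: "bits \<Rightarrow> bits \<Rightarrow> bits" (infixl "\<oplus>\<^sub>2" 65) where
  "x \<oplus>\<^sub>2 y = map2 (+) x y"

definition block :: "nat \<Rightarrow> nat \<Rightarrow> bits \<Rightarrow> bits" where
  "block w j x = take w (drop (j * w) x)"

definition uniform_bits :: "nat \<Rightarrow> bits pmf" where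
  "uniform_bits b = pmf_of_set {x. length x = b}"


section \<open>The LFSR hash family\<close>

definition connection_poly :: "bits \<Rightarrow> bit poly" where
  "connection_poly p = monom 1 (length p) + (\<Sum>i<length p. monom (rev p ! i) i)"

fun lfsr :: "bits \<Rightarrow> bits \<Rightarrow> nat \<Rightarrow> bit" where
  "lfsr p s l =
     (if l < length p then rev s ! l
      else (\<Sum>i<length p. rev p ! i * lfsr p s (l - length p + i)))"

declare lfsr.simps [simp del]

definition lfsr_state :: "bits \<Rightarrow> bits \<Rightarrow> nat \<Rightarrow> bits" where
  "lfsr_state p s k = map (\<lambda>i. lfsr p s (i + k)) (rev [0..<length p])"

text \<open>
  \<open>lfsr_hash p s m\<close> is the product of \<open>m\<close> with the matrix whose columns are the states
  \<open>s\<^sup>0, \<dots>, s\<^sup>b\<^sup>-\<^sup>1\<close>, \<open>b = length m\<close>. It is defined for every \<open>p\<close> and \<open>s\<close>: a string \<open>p'\<close> decrypted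
  from a signature, and the uniformly random \<open>s\<close> in a key block, are used as they are.
\<close>

definition lfsr_hash :: "bits \<Rightarrow> bits \<Rightarrow> bits \<Rightarrow> bits" where
  "lfsr_hash p s m =
     map (\<lambda>i. \<Sum>k<length m. lfsr_state p s k ! i * m ! k) [0..<length p]"

text \<open>The functions of the family are represented by their indices \<open>(p, s)\<close>.\<close>

definition axu_family :: "nat \<Rightarrow> (bits \<times> bits) set" where
  "axu_family b = {(p, s). length p = b \<and> irreducible (connection_poly p) \<and>
                           length s = b \<and> s \<noteq> replicate b 0}"


section \<open>Channels between Bob and Charlie\<close>

text \<open>
  What travels over a channel is a pair of a payload (plaintext or ciphertext) and a tag.
  Receiving yields \<open>None\<close> if authentication fails. The length of every message is fixed by
  the protocol, and another length is not accepted. The secret channel encrypts with a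
  one-time pad \<open>K\<close>; the tag is that of the plaintext.
\<close>

type_synonym transmission = "bits \<times> bits"

definition wc_tag :: "bits \<times> bits \<Rightarrow> bits \<Rightarrow> bits \<Rightarrow> bits" where
  "wc_tag f k m = lfsr_hash (fst f) (snd f) m \<oplus>\<^sub>2 k"

definition auth_send :: "bits \<times> bits \<Rightarrow> bits \<Rightarrow> bits \<Rightarrow> transmission" where
  "auth_send f k m = (m, wc_tag f k m)"

definition auth_receive :: "nat \<Rightarrow> bits \<times> bits \<Rightarrow> bits \<Rightarrow> transmission \<Rightarrow> bits option" where
  "auth_receive len f k = (\<lambda>(m, t).
     if length m = len \<and> t = wc_tag f k m then Some m else None)"

definition secret_send :: "bits \<times> bits \<Rightarrow> bits \<Rightarrow> bits \<Rightarrow> bits \<Rightarrow> transmission" where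
  "secret_send f k K m = (m \<oplus>\<^sub>2 K, wc_tag f k m)"

definition secret_receive ::
  "nat \<Rightarrow> bits \<times> bits \<Rightarrow> bits \<Rightarrow> bits \<Rightarrow> transmission \<Rightarrow> bits option" where
  "secret_receive len f k K = (\<lambda>(c, t).
     if length c = len \<and> t = wc_tag f k (c \<oplus>\<^sub>2 K) then Some (c \<oplus>\<^sub>2 K) else None)"


section \<open>The protocol\<close>

text \<open>Blocks, signatures and positions are numbered from 0.\<close>

definition blocks_length :: "nat \<Rightarrow> nat \<Rightarrow> nat" where
  "blocks_length n b\<^sub>H = (n div 2) * (3 * b\<^sub>H)"

text \<open>
  If \<open>n\<close> is not a power of 2, then \<open>(n/2) log\<^sub>2 n\<close> need not be an integer; it is rounded up, which
  still leaves enough strings to encode all lists of \<open>n/2\<close> positions.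
\<close>

definition positions_length :: "nat \<Rightarrow> nat" where
  "positions_length n = nat \<lceil>real n / 2 * log 2 (real n)\<rceil>"

definition position_code :: "nat \<Rightarrow> (nat list \<Rightarrow> bits) \<Rightarrow> (bits \<Rightarrow> nat list) \<Rightarrow> bool" where
  "position_code n enc dec \<longleftrightarrow>
     (\<forall>js. length js = n div 2 \<and> set js \<subseteq> {..<n} \<longrightarrow>
           length (enc js) = positions_length n \<and> dec (enc js) = js)"

lemma position_code_exists:
  assumes "even n" "0 < n"
  shows "\<exists>enc dec. position_code n enc dec"
proof -
  define A where "A = {js. set js \<subseteq> {..<n} \<and> length js = n div 2}"
  define B where "B = {x :: bits. set x \<subseteq> UNIV \<and> length x = positions_length n}"
  have U: "(UNIV :: bit set) = {0, 1}" by (auto intro: bit.exhaust)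
  have finA: "finite A" unfolding A_def by (rule finite_lists_length_eq) simp
  have finB: "finite B" unfolding B_def by (rule finite_lists_length_eq) (simp add: U)
  have cardA: "card A = n ^ (n div 2)"
    unfolding A_def by (subst card_lists_length_eq) auto
  have cardB: "card B = 2 ^ positions_length n"
    unfolding B_def by (subst card_lists_length_eq) (auto simp: U numeral_2_eq_2)
  have "real (n ^ (n div 2)) = real n powr real (n div 2)"
    using assms by (simp add: powr_realpow)
  also have "\<dots> = 2 powr (real (n div 2) * log 2 (real n))"
    using assms by (simp add: powr_def log_def)
  also have "\<dots> \<le> 2 powr real (positions_length n)"
  proof -
    have "real (n div 2) = real n / 2" using assms by (auto elim: evenE)
    moreover have "real n / 2 * log 2 (real n) \<le> real (positions_length n)"
      unfolding positions_length_def by (rule of_nat_ceiling)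
    ultimately have "real (n div 2) * log 2 (real n) \<le> real (positions_length n)" by metis
    then show ?thesis by simp
  qed
  also have "\<dots> = real (2 ^ positions_length n)" by (simp add: powr_realpow)
  finally have "card A \<le> card B" unfolding cardA cardB by (simp only: of_nat_le_iff)
  then obtain enc where enc: "enc ` A \<subseteq> B" "inj_on enc A"
    using card_le_inj[OF finA finB] by blast
  have "position_code n enc (inv_into A enc)"
    unfolding position_code_def
  proof (intro allI impI)
    fix js assume "length js = n div 2 \<and> set js \<subseteq> {..<n}"
    then have "js \<in> A" by (simp add: A_def)
    then show "length (enc js) = positions_length n \<and> inv_into A enc (enc js) = js"
      using enc by (auto simp: B_def)
  qed
  then show ?thesis by blast
qed

definition kept_blocks :: "nat \<Rightarrow> nat \<Rightarrow> bits \<Rightarrow> (nat \<Rightarrow> nat) \<Rightarrow> bits" where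
  "kept_blocks n b\<^sub>H X \<gamma> = concat (map (\<lambda>i. block (3 * b\<^sub>H) (\<gamma> i) X) [0..<n div 2])"

definition signature_ok :: "nat \<Rightarrow> bits \<Rightarrow> bits \<Rightarrow> bits \<Rightarrow> bool" where
  "signature_ok b\<^sub>H Doc sg X =
     (let s = take b\<^sub>H X; r = drop b\<^sub>H X;
          d = sg \<oplus>\<^sub>2 r; h' = take b\<^sub>H d; p' = drop b\<^sub>H d
      in h' = lfsr_hash p' s Doc)"

text \<open>
  \<open>Y\<close> and \<open>js\<close> are the key blocks and the positions received from the other user.
\<close>

definition Bob_accepts ::
  "nat \<Rightarrow> nat \<Rightarrow> nat \<Rightarrow> bits \<Rightarrow> bits \<Rightarrow> nat list \<Rightarrow> bits \<Rightarrow> bits \<Rightarrow> bool" where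
  "Bob_accepts n b\<^sub>M b\<^sub>H X\<^sub>B Y js Doc Sig \<longleftrightarrow>
     length Doc = b\<^sub>M \<and> length Sig = 4 * n * b\<^sub>H \<and>
     (\<forall>j<n. signature_ok b\<^sub>H Doc (block (2 * b\<^sub>H) j Sig) (block (3 * b\<^sub>H) j X\<^sub>B)) \<and>
     (\<forall>i<n div 2. signature_ok b\<^sub>H Doc (block (2 * b\<^sub>H) (n + js ! i) Sig) (block (3 * b\<^sub>H) i Y))"

definition Charlie_mismatches ::
  "nat \<Rightarrow> nat \<Rightarrow> bits \<Rightarrow> bits \<Rightarrow> nat list \<Rightarrow> bits \<Rightarrow> bits \<Rightarrow> nat" where
  "Charlie_mismatches n b\<^sub>H X\<^sub>C Y js Doc Sig =
     card {j. j < n \<and>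
       \<not> signature_ok b\<^sub>H Doc (block (2 * b\<^sub>H) (n + j) Sig) (block (3 * b\<^sub>H) j X\<^sub>C)} +
     card {i. i < n div 2 \<and>
       \<not> signature_ok b\<^sub>H Doc (block (2 * b\<^sub>H) (js ! i) Sig) (block (3 * b\<^sub>H) i Y)}"

datatype outcome = Aborted | Rejected_by_Bob | Accepted_by_Bob (Charlie_accepts: bool)


section \<open>The repudiation attack\<close>

text \<open>
  The four transmissions of the distribution stage: blocks and positions sent by Bob, then
  blocks and positions sent by Charlie.
\<close>

type_synonym traffic = "transmission \<times> transmission \<times> transmission \<times> transmission"

text \<open>
  A strategy of Alice: her private randomness \<open>coins\<close> and, for each of its values, arbitrary
  (not necessarily computable) functions of what she has seen so far, the keys \<open>X\<^sub>B\<close>, \<open>X\<^sub>C\<close>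
  included. She sees all of the distribution traffic before replacing any part of it; this
  covers every order in which the four messages may be sent.
\<close>

record 'r alice =
  coins :: "'r pmf"
  tamper_distribution :: "'r \<Rightarrow> bits \<Rightarrow> bits \<Rightarrow> traffic \<Rightarrow> traffic"
  choose_pair :: "'r \<Rightarrow> bits \<Rightarrow> bits \<Rightarrow> traffic \<Rightarrow> bits \<times> bits"
  tamper_forwarded :: "'r \<Rightarrow> bits \<Rightarrow> bits \<Rightarrow> traffic \<Rightarrow> transmission \<Rightarrow> transmission"

text \<open>
  The messaging stage after both users have authenticated the distribution messages.
  If Bob rejects, the run ends with that outcome; his message to Charlie is immaterial.
\<close>

definition messaging_outcome ::
  "nat \<Rightarrow> nat \<Rightarrow> nat \<Rightarrow> nat \<Rightarrow> bits \<Rightarrow> bits \<Rightarrow> bits \<times> nat list \<Rightarrow> bits \<times> nat list \<Rightarrow>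
   bits \<times> bits \<Rightarrow> bits \<Rightarrow> bits \<times> bits \<Rightarrow> (transmission \<Rightarrow> transmission) \<Rightarrow> outcome" where
  "messaging_outcome n e\<^sub>m\<^sub>a\<^sub>x b\<^sub>M b\<^sub>H X\<^sub>B X\<^sub>C from_Bob from_Charlie f k pair tamper =
     (let (Doc, Sig) = pair;
          (Y\<^sub>B, js\<^sub>B) = from_Bob;
          (Y\<^sub>C, js\<^sub>C) = from_Charlie
      in if \<not> Bob_accepts n b\<^sub>M b\<^sub>H X\<^sub>B Y\<^sub>C js\<^sub>C Doc Sig then Rejected_by_Bob
         else case auth_receive (b\<^sub>M + 4 * n * b\<^sub>H) f k (tamper (auth_send f k (Doc @ Sig))) of
                None \<Rightarrow> Aborted
              | Some m \<Rightarrow> Accepted_by_Bob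
                  (Charlie_mismatches n b\<^sub>H X\<^sub>C Y\<^sub>B js\<^sub>B (take b\<^sub>M m) (drop b\<^sub>M m) \<le> e\<^sub>m\<^sub>a\<^sub>x))"

text \<open>
  \<open>f\<close> is recycled for all five messages; every message has its own tag key \<open>k\<close>, and every secret
  message its own pad \<open>K\<close>.
\<close>

definition repudiation_game ::
  "nat \<Rightarrow> nat \<Rightarrow> nat \<Rightarrow> nat \<Rightarrow> nat \<Rightarrow> (nat list \<Rightarrow> bits) \<Rightarrow> (bits \<Rightarrow> nat list) \<Rightarrow> 'r alice \<Rightarrow>
   outcome pmf" where
  "repudiation_game n e\<^sub>m\<^sub>a\<^sub>x b\<^sub>M b\<^sub>H b\<^sub>H' enc dec A =
   do {
     \<omega> \<leftarrow> coins A;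
     X\<^sub>B \<leftarrow> uniform_bits (n * (3 * b\<^sub>H));
     X\<^sub>C \<leftarrow> uniform_bits (n * (3 * b\<^sub>H));
     \<gamma>\<^sub>B \<leftarrow> pmf_of_set {\<pi>. \<pi> permutes {..<n}};
     \<gamma>\<^sub>C \<leftarrow> pmf_of_set {\<pi>. \<pi> permutes {..<n}};
     f \<leftarrow> pmf_of_set (axu_family b\<^sub>H');
     k\<^sub>1 \<leftarrow> uniform_bits b\<^sub>H';
     k\<^sub>2 \<leftarrow> uniform_bits b\<^sub>H';
     k\<^sub>3 \<leftarrow> uniform_bits b\<^sub>H';
     k\<^sub>4 \<leftarrow> uniform_bits b\<^sub>H';
     k\<^sub>5 \<leftarrow> uniform_bits b\<^sub>H';
     K\<^sub>1 \<leftarrow> uniform_bits (blocks_length n b\<^sub>H);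
     K\<^sub>2 \<leftarrow> uniform_bits (positions_length n);
     K\<^sub>3 \<leftarrow> uniform_bits (blocks_length n b\<^sub>H);
     K\<^sub>4 \<leftarrow> uniform_bits (positions_length n);
     let sent =
       (secret_send f k\<^sub>1 K\<^sub>1 (kept_blocks n b\<^sub>H X\<^sub>B \<gamma>\<^sub>B),
        secret_send f k\<^sub>2 K\<^sub>2 (enc (map \<gamma>\<^sub>B [0..<n div 2])),
        secret_send f k\<^sub>3 K\<^sub>3 (kept_blocks n b\<^sub>H X\<^sub>C \<gamma>\<^sub>C),
        secret_send f k\<^sub>4 K\<^sub>4 (enc (map \<gamma>\<^sub>C [0..<n div 2])));
     let (d\<^sub>1, d\<^sub>2, d\<^sub>3, d\<^sub>4) = tamper_distribution A \<omega> X\<^sub>B X\<^sub>C sent;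
     return_pmf
       (case (secret_receive (blocks_length n b\<^sub>H) f k\<^sub>1 K\<^sub>1 d\<^sub>1,
              secret_receive (positions_length n) f k\<^sub>2 K\<^sub>2 d\<^sub>2,
              secret_receive (blocks_length n b\<^sub>H) f k\<^sub>3 K\<^sub>3 d\<^sub>3,
              secret_receive (positions_length n) f k\<^sub>4 K\<^sub>4 d\<^sub>4) of
          (Some Y\<^sub>B, Some c\<^sub>B, Some Y\<^sub>C, Some c\<^sub>C) \<Rightarrow>
            messaging_outcome n e\<^sub>m\<^sub>a\<^sub>x b\<^sub>M b\<^sub>H X\<^sub>B X\<^sub>C (Y\<^sub>B, dec c\<^sub>B) (Y\<^sub>C, dec c\<^sub>C) f k\<^sub>5
              (choose_pair A \<omega> X\<^sub>B X\<^sub>C sent) (tamper_forwarded A \<omega> X\<^sub>B X\<^sub>C sent)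
        | _ \<Rightarrow> Aborted)
   }"

end

theory Submission
  imports Defs "HOL-Computational_Algebra.Polynomial_Factorial"
begin

text \<open>
  Given the messages and the hash function \<open>f\<close>, the one-time pads and tag keys are in bijection with
  the ciphertexts and tags on the channel. Hence what Alice sees is independent of \<open>f\<close> and of the
  permutations, and it suffices to bound the success probability for each fixed view, which also
  fixes everything she sends. If she modifies a transmission \<open>(c, t)\<close> into \<open>(c', t')\<close>, linearity of the
  hash turns acceptance into the single equation \<open>f(c' \<oplus> c) = t' \<oplus> t\<close>, whose probability is bounded by
  the AXU property. If she modifies nothing, the set of bad signatures on Charlie's side is fixed,
  has more than \<open>e\<^sub>m\<^sub>a\<^sub>x\<close> elements, and must be missed entirely by \<open>\<gamma>\<^sub>C(1), \<dots>, \<gamma>\<^sub>C(n/2)\<close>. One of the two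
  cases applies to each view, which is why the bound is a maximum and not a sum.

  The AXU property rests on two facts: for \<open>p\<close> irreducible and \<open>s \<noteq> 0\<close> the hash of \<open>m\<close> vanishes iff
  \<open>p(x)\<close> divides \<open>\<Sum>\<^sub>k m\<^sub>k x\<^sup>k\<close>, and there are at least \<open>2\<^sup>b\<^sup>-\<^sup>1/b\<close> irreducible polynomials of degree \<open>b\<close>.
  For the latter, counting the prime power divisors of all polynomials of degree \<open>n\<close> in two ways
  gives \<open>n 2\<^sup>n = \<Sum> deg P \<cdot> 2\<^sup>n\<^sup>-\<^sup>k\<^sup>d\<^sup>e\<^sup>g\<^sup>P\<close> over the \<open>(P, k)\<close> with \<open>k deg P \<le> n\<close>, and subtracting twice the
  identity for \<open>n - 1\<close> leaves \<open>\<Sum> deg P = 2\<^sup>n\<close> over the \<open>(P, k)\<close> with \<open>k deg P = n\<close>.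
\<close>

section \<open>Irreducible polynomials over GF(2)\<close>

lemma UNIV_bit: "(UNIV :: bit set) = {0, 1}"
  by (auto intro: bit.exhaust)

lemma finite_bit_strings: "finite {x :: bits. length x = b}"
proof -
  have "finite (UNIV :: bit set)" by (simp add: UNIV_bit)
  then show ?thesis using finite_lists_length_eq[of "UNIV :: bit set" b] by simp
qed

lemma card_bit_strings: "card {x :: bits. length x = b} = 2 ^ b"
proof -
  have "finite (UNIV :: bit set)" "card (UNIV :: bit set) = 2" by (simp_all add: UNIV_bit)
  then show ?thesis using card_lists_length_eq[of "UNIV :: bit set" b] by simp
qed

text \<open>Every nonzero polynomial over GF(2) is monic, so no leading coefficient has to be fixed;
  0 is excluded because its \<open>degree\<close> is 0 by convention.\<close>

definition polys_of_degree :: "nat \<Rightarrow> bit poly set" where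
  "polys_of_degree d = {f. f \<noteq> 0 \<and> degree f = d}"

lemma coeff_connection_poly:
  "coeff (connection_poly p) i =
     (if i < length p then rev p ! i else if i = length p then 1 else 0)"
proof -
  have "(\<Sum>j<length p. coeff (monom (rev p ! j) j) i) = (\<Sum>j<length p. if i = j then rev p ! j else 0)"
    by (intro sum.cong) auto
  then show ?thesis by (simp add: connection_poly_def coeff_sum)
qed

lemma degree_connection_poly: "degree (connection_poly p) = length p"
proof (rule antisym)
  show "degree (connection_poly p) \<le> length p"
    by (rule degree_le) (simp add: coeff_connection_poly)
  show "length p \<le> degree (connection_poly p)"
    by (rule le_degree) (simp add: coeff_connection_poly)
qed

text \<open>A leading coefficient over GF(2) can only be 1, so a polynomial of degree d is given by
  its d lower coefficients. They are listed in reverse, since the leftmost bit of a string has the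
  highest index.\<close>

lemma bij_betw_connection_poly:
  "bij_betw connection_poly {p. length p = d} (polys_of_degree d)"
  unfolding bij_betw_def
proof (intro conjI equalityI subsetI)
  show "inj_on connection_poly {p. length p = d}"
  proof (rule inj_onI, clarsimp)
    fix p q :: bits
    assume eq: "connection_poly p = connection_poly q" "d = length p" "length q = length p"
    have "rev p ! i = rev q ! i" if "i < length p" for i
      using coeff_connection_poly[of p i] coeff_connection_poly[of q i] eq that by simp
    then have "rev p = rev q"
      using eq by (intro nth_equalityI) auto
    then show "p = q" by simp
  qed
next
  fix f assume "f \<in> connection_poly ` {p. length p = d}"
  then obtain p where p: "f = connection_poly p" "length p = d" by blast
  moreover have "connection_poly p \<noteq> 0"
    using coeff_connection_poly[of p "length p"] by auto
  ultimately show "f \<in> polys_of_degree d"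
    by (simp add: polys_of_degree_def degree_connection_poly)
next
  fix f assume "f \<in> polys_of_degree d"
  then have f: "f \<noteq> 0" "degree f = d" by (auto simp: polys_of_degree_def)
  define p where "p = rev (map (coeff f) [0..<d])"
  have "coeff (connection_poly p) i = coeff f i" for i
  proof -
    have "coeff f d = 1" using f leading_coeff_0_iff[of f] by simp
    moreover have "coeff f i = 0" if "i > d" using that f coeff_eq_0 by blast
    ultimately show ?thesis by (auto simp: coeff_connection_poly p_def)
  qed
  then have "connection_poly p = f" by (rule poly_eqI)
  moreover have "length p = d" by (simp add: p_def)
  ultimately show "f \<in> connection_poly ` {p. length p = d}" by blast
qed

lemma finite_polys_of_degree: "finite (polys_of_degree d)"
  using bij_betw_finite[OF bij_betw_connection_poly] finite_bit_strings by blast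

lemma card_polys_of_degree: "card (polys_of_degree d) = 2 ^ d"
  using bij_betw_same_card[OF bij_betw_connection_poly] card_bit_strings by metis

text \<open>Division by Q maps the multiples of degree n bijectively onto all polynomials of degree
  \<open>n - degree Q\<close>.\<close>

lemma card_multiples_of_degree:
  assumes "Q \<noteq> 0" and "degree Q \<le> n"
  shows "card {f \<in> polys_of_degree n. Q dvd f} = 2 ^ (n - degree Q)"
proof -
  have "{f \<in> polys_of_degree n. Q dvd f} = (*) Q ` polys_of_degree (n - degree Q)"
  proof (intro equalityI subsetI)
    fix f assume "f \<in> {f \<in> polys_of_degree n. Q dvd f}"
    then obtain g where g: "f = Q * g" and f: "f \<noteq> 0" "degree f = n"
      by (auto simp: polys_of_degree_def)
    then have "g \<in> polys_of_degree (n - degree Q)"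
      by (auto simp: polys_of_degree_def degree_mult_eq)
    with g show "f \<in> (*) Q ` polys_of_degree (n - degree Q)" by blast
  qed (use assms in \<open>auto simp: polys_of_degree_def degree_mult_eq\<close>)
  moreover have "inj_on ((*) Q) (polys_of_degree (n - degree Q))"
    using assms by (intro inj_onI) simp
  ultimately show ?thesis
    by (simp add: card_image card_polys_of_degree)
qed

section \<open>Units and irreducible polynomials over GF(2)\<close>

lemma bit_poly_unit_iff: "is_unit f \<longleftrightarrow> f = 1" for f :: "bit poly"
proof
  assume "is_unit f"
  then obtain c where c: "f = [:c:]" "c \<noteq> 0" by (auto simp: is_unit_poly_iff)
  then show "f = 1" by simp
qed simp

lemma irreducible_degree_pos: "irreducible P \<Longrightarrow> 0 < degree P" for P :: "bit poly"
proof (rule ccontr)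
  assume P: "irreducible P" and "\<not> 0 < degree P"
  moreover have "P \<noteq> 0" using P by auto
  ultimately have "is_unit P" using is_unit_iff_degree[of P] by auto
  then show False using P irreducible_not_unit by blast
qed

text \<open>The cofactor is a unit, and 1 is the only unit over GF(2); irreducibles need no
  normalisation up to associates.\<close>

lemma irreducible_dvd_irreducible_bit:
  fixes P Q :: "bit poly"
  assumes "irreducible P" "irreducible Q" "P dvd Q"
  shows "P = Q"
proof -
  obtain r where r: "Q = P * r" using assms(3) by blast
  then have "is_unit P \<or> is_unit r" using assms(2) irreducibleD by blast
  then have "r = 1" using assms(1) bit_poly_unit_iff irreducible_not_unit by blast
  with r show ?thesis by simp
qed

text \<open>A divisor of least positive degree is irreducible: in a factorisation of it, a factor of
  positive degree is again such a divisor, which leaves degree 0 for the other factor.\<close>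

lemma irreducible_divisor_exists:
  fixes f :: "bit poly"
  assumes "f \<noteq> 0" "\<not> is_unit f"
  obtains Q where "irreducible Q" "Q dvd f"
proof -
  define S where "S = {Q. Q dvd f \<and> 0 < degree Q}"
  have "f \<in> S" using assms is_unit_iff_degree[of f] by (auto simp: S_def)
  define Q where "Q = arg_min degree (\<lambda>Q. Q \<in> S)"
  have Q: "Q \<in> S" and min: "\<And>P. P \<in> S \<Longrightarrow> degree Q \<le> degree P"
    unfolding Q_def using arg_min_nat_lemma[of "\<lambda>Q. Q \<in> S" f degree] \<open>f \<in> S\<close> by auto
  have "Q \<noteq> 0" using Q by (auto simp: S_def)
  have "irreducible Q"
  proof (rule irreducibleI)
    show "Q \<noteq> 0" by fact
    show "\<not> is_unit Q" using Q is_unit_iff_degree[OF \<open>Q \<noteq> 0\<close>] by (auto simp: S_def)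
    fix a b assume ab: "Q = a * b"
    then have nz: "a \<noteq> 0" "b \<noteq> 0" using \<open>Q \<noteq> 0\<close> by auto
    then have deg: "degree Q = degree a + degree b" using ab by (simp add: degree_mult_eq)
    show "is_unit a \<or> is_unit b"
    proof (cases "degree a = 0")
      case False
      have "a dvd f" using Q ab by (auto simp: S_def dest: dvd_mult_left)
      then have "a \<in> S" using False by (simp add: S_def)
      then have "degree b = 0" using min[of a] deg by simp
      then show ?thesis using nz is_unit_iff_degree by blast
    qed (use nz is_unit_iff_degree in blast)
  qed
  with Q that show thesis by (auto simp: S_def)
qed

section \<open>Counting prime power divisors\<close>

definition prime_power_divisors :: "bit poly \<Rightarrow> (bit poly \<times> nat) set" where
  "prime_power_divisors f = {(P, k). irreducible P \<and> 0 < k \<and> P ^ k dvd f}"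

lemma degree_power_bit: "P \<noteq> 0 \<Longrightarrow> degree (P ^ k) = k * degree P" for P :: "bit poly"
  by (induction k) (auto simp: degree_mult_eq)

lemma prime_power_divisors_degree:
  assumes "(P, k) \<in> prime_power_divisors f" "f \<noteq> 0"
  shows "k * degree P \<le> degree f" "0 < k" "irreducible P" "0 < degree P"
proof -
  have *: "irreducible P" "0 < k" "P ^ k dvd f"
    using assms(1) by (auto simp: prime_power_divisors_def)
  then have "P \<noteq> 0" by auto
  then show "k * degree P \<le> degree f"
    using dvd_imp_degree_le[OF *(3) assms(2)] degree_power_bit by simp
  show "0 < k" "irreducible P" using * by auto
  then show "0 < degree P" using irreducible_degree_pos by blast
qed

definition prime_powers_upto :: "nat \<Rightarrow> (bit poly \<times> nat) set" where
  "prime_powers_upto n = {(P, k). irreducible P \<and> 0 < k \<and> k * degree P \<le> n}"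

lemma finite_prime_powers_upto: "finite (prime_powers_upto n)"
proof (rule finite_subset)
  show "prime_powers_upto n \<subseteq> (\<Union>d\<le>n. polys_of_degree d) \<times> {..n}"
  proof (rule subrelI)
    fix P k assume "(P, k) \<in> prime_powers_upto n"
    then have *: "irreducible P" "0 < k" "k * degree P \<le> n" by (auto simp: prime_powers_upto_def)
    have "1 * degree P \<le> k * degree P" "k * 1 \<le> k * degree P"
      using * irreducible_degree_pos[OF *(1)] by (intro mult_le_mono; simp)+
    then have "degree P \<le> n" "k \<le> n" using * by linarith+
    moreover have "P \<noteq> 0" using * by auto
    ultimately show "(P, k) \<in> (\<Union>d\<le>n. polys_of_degree d) \<times> {..n}"
      by (auto simp: polys_of_degree_def)
  qed
qed (simp add: finite_polys_of_degree)

lemma prime_power_divisors_subset: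
  assumes "f \<noteq> 0"
  shows "prime_power_divisors f \<subseteq> prime_powers_upto (degree f)"
proof (rule subrelI)
  fix P k assume "(P, k) \<in> prime_power_divisors f"
  from prime_power_divisors_degree[OF this assms]
  show "(P, k) \<in> prime_powers_upto (degree f)" by (simp add: prime_powers_upto_def)
qed

lemma finite_prime_power_divisors: "f \<noteq> 0 \<Longrightarrow> finite (prime_power_divisors f)"
  using finite_subset[OF prime_power_divisors_subset finite_prime_powers_upto] .

text \<open>Multiplying by Q raises the multiplicity of Q by one and leaves that of every other
  irreducible unchanged, because irreducible polynomials are prime. So exactly one pair is
  new.\<close>

lemma prime_power_divisors_mult:
  assumes Q: "irreducible Q" and g: "g \<noteq> 0"
  obtains m where "prime_power_divisors (Q * g) = insert (Q, m) (prime_power_divisors g)"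
    and "(Q, m) \<notin> prime_power_divisors g"
proof -
  have Q0: "Q \<noteq> 0" "0 < degree Q" using Q irreducible_degree_pos by auto
  define K where "K = {k. Q ^ k dvd g}"
  have "k \<le> degree g" if "k \<in> K" for k
  proof -
    have "k * degree Q \<le> degree g"
      using that dvd_imp_degree_le[of "Q ^ k" g] g degree_power_bit[OF Q0(1), of k]
      by (simp add: K_def)
    moreover have "k \<le> k * degree Q" using Q0 by simp
    ultimately show ?thesis by linarith
  qed
  then have finK: "finite K" by (meson finite_nat_set_iff_bounded_le)
  have "0 \<in> K" by (simp add: K_def)
  \<comment> \<open>The new multiplicity of Q, one more than its multiplicity \<open>Max K\<close>
    in g.\<close>
  define m where "m = Suc (Max K)"
  have KM: "k \<in> K \<longleftrightarrow> k < m" for k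
  proof
    assume "k < m"
    then have "k \<le> Max K" by (simp add: m_def)
    moreover have "Q ^ Max K dvd g" using Max_in[OF finK] \<open>0 \<in> K\<close> unfolding K_def by blast
    ultimately show "k \<in> K" by (auto simp: K_def intro: power_le_dvd)
  qed (use finK in \<open>auto simp: m_def less_Suc_eq_le\<close>)
  have Qpow: "Q ^ Suc k dvd Q * g \<longleftrightarrow> k < m" for k
    using Q0 KM[of k] by (simp add: K_def)
  have *: "(P, k) \<in> prime_power_divisors (Q * g) \<longleftrightarrow>
        (P, k) = (Q, m) \<or> (P, k) \<in> prime_power_divisors g" for P k
  proof (cases "P = Q")
    case True
    have "0 < m" by (simp add: m_def)
    have "Q ^ k dvd Q * g \<longleftrightarrow> k \<le> m" using Qpow[of "k - 1"] \<open>0 < m\<close> by (cases k) auto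
    moreover have "Q ^ k dvd g \<longleftrightarrow> k < m" using KM[of k] by (simp add: K_def)
    ultimately show ?thesis using True Q \<open>0 < m\<close> by (auto simp: prime_power_divisors_def)
  next
    case False
    have "P ^ k dvd Q * g \<longleftrightarrow> P ^ k dvd g" if "irreducible P" "0 < k"
    proof
      assume "P ^ k dvd Q * g"
      moreover have "\<not> P dvd Q" using irreducible_dvd_irreducible_bit False Q that by blast
      moreover have "prime_elem P" using field_poly_irreducible_imp_prime that by blast
      ultimately show "P ^ k dvd g" using prime_power_dvd_multD that by blast
    qed simp
    then show ?thesis using False by (auto simp: prime_power_divisors_def)
  qed
  have "prime_power_divisors (Q * g) = insert (Q, m) (prime_power_divisors g)"
    by (rule set_eqI) (use * in \<open>metis insert_iff prod.exhaust\<close>)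
  moreover have "(Q, m) \<notin> prime_power_divisors g"
    using KM[of m] by (simp add: K_def prime_power_divisors_def)
  ultimately show ?thesis using that by blast
qed

text \<open>An irreducible P occurs in \<open>prime_power_divisors f\<close> once for each k up to
  its multiplicity, so degrees are summed with multiplicity. Splitting off an irreducible factor Q
  removes one pair and \<open>degree Q\<close> from the total.\<close>

lemma sum_degree_prime_power_divisors:
  assumes "f \<noteq> 0"
  shows "(\<Sum>(P, k) \<in> prime_power_divisors f. degree P) = degree f"
  using assms
proof (induction "degree f" arbitrary: f rule: less_induct)
  case less
  show ?case
  proof (cases "degree f = 0")
    case True
    have "prime_power_divisors f = {}"
    proof (rule equals0I)
      fix x assume "x \<in> prime_power_divisors f"
      then have "(fst x, snd x) \<in> prime_power_divisors f" by simp
      from prime_power_divisors_degree[OF this less.prems] True show False by simp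
    qed
    then show ?thesis using True by simp
  next
    case False
    have "\<exists>Q g. irreducible Q \<and> f = Q * g"
    proof -
      have "\<not> is_unit f" using False is_unit_iff_degree[OF less.prems] by simp
      from irreducible_divisor_exists[OF less.prems this]
      obtain Q where "irreducible Q" "Q dvd f" .
      then show ?thesis by (auto simp: dvd_def)
    qed
    then obtain Q g where Qg: "irreducible Q" "f = Q * g" by blast
    then have g: "g \<noteq> 0" using less.prems by auto
    have Q: "Q \<noteq> 0" "0 < degree Q" using Qg irreducible_degree_pos by auto
    have deg: "degree f = degree Q + degree g" using Qg g Q by (simp add: degree_mult_eq)
    obtain m where m: "prime_power_divisors (Q * g) = insert (Q, m) (prime_power_divisors g)"
      "(Q, m) \<notin> prime_power_divisors g"
      using prime_power_divisors_mult[OF Qg(1) g] .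
    show ?thesis
      using less.hyps[of g] deg Q g m finite_prime_power_divisors[OF g] by (simp add: Qg(2))
  qed
qed

text \<open>Double counting of the triples (f, P, k) with f of degree n and P^k dividing f, weighted
  by deg P: each f contributes n, and each (P, k) has 2^(n - k deg P) multiples f.\<close>

lemma sum_prime_powers_upto:
  "(\<Sum>(P, k) \<in> prime_powers_upto n. degree P * 2 ^ (n - k * degree P)) = n * 2 ^ n"
proof -
  have "(\<Sum>f\<in>polys_of_degree n. degree f) = (\<Sum>f\<in>polys_of_degree n. n)"
    by (intro sum.cong) (auto simp: polys_of_degree_def)
  then have "n * 2 ^ n = (\<Sum>f\<in>polys_of_degree n. degree f)"
    by (simp add: card_polys_of_degree)
  also have "\<dots> = (\<Sum>f\<in>polys_of_degree n. \<Sum>x \<in> prime_power_divisors f. degree (fst x))"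
    using sum_degree_prime_power_divisors
    by (intro sum.cong) (auto simp: polys_of_degree_def case_prod_unfold)
  also have "\<dots> = (\<Sum>f\<in>polys_of_degree n. \<Sum>x \<in> {x \<in> prime_powers_upto n. x \<in> prime_power_divisors f}. degree (fst x))"
    using prime_power_divisors_subset
    by (intro sum.cong refl) (auto simp: polys_of_degree_def)
  also have "\<dots> = (\<Sum>x\<in>prime_powers_upto n. \<Sum>f \<in> {f \<in> polys_of_degree n. x \<in> prime_power_divisors f}. degree (fst x))"
    by (rule sum.swap_restrict) (auto simp: finite_polys_of_degree finite_prime_powers_upto)
  also have "\<dots> = (\<Sum>(P, k) \<in> prime_powers_upto n. degree P * 2 ^ (n - k * degree P))"
  proof (intro sum.cong refl, clarsimp simp del: sum_constant)
    fix P :: "bit poly" and k assume "(P, k) \<in> prime_powers_upto n"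
    then have *: "irreducible P" "0 < k" "k * degree P \<le> n" by (auto simp: prime_powers_upto_def)
    then have "P \<noteq> 0" by auto
    then have "card {f \<in> polys_of_degree n. P ^ k dvd f} = 2 ^ (n - k * degree P)"
      using card_multiples_of_degree[of "P ^ k" n] * by (simp add: degree_power_bit)
    then show "(\<Sum>f \<in> {f \<in> polys_of_degree n. (P, k) \<in> prime_power_divisors f}. degree P) =
       degree P * 2 ^ (n - k * degree P)"
      using * by (simp add: prime_power_divisors_def)
  qed
  finally show ?thesis by simp
qed

text \<open>Difference of the identity for n and twice the identity for n - 1: the pairs with k deg
  P < n cancel, and n 2^n - 2 (n - 1) 2^(n - 1) = 2^n.\<close>

lemma sum_prime_powers_of_degree:
  assumes "0 < n"
  shows "(\<Sum>(P, k) \<in> {(P :: bit poly, k). irreducible P \<and> 0 < k \<and> k * degree P = n}. degree P) = 2 ^ n"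
proof -
  obtain l where n: "n = Suc l" using assms gr0_conv_Suc by blast
  define Q where "Q = {(P :: bit poly, k). irreducible P \<and> 0 < k \<and> k * degree P = n}"
  have un: "prime_powers_upto n = prime_powers_upto l \<union> Q" and dis: "prime_powers_upto l \<inter> Q = {}"
    by (auto simp: Q_def prime_powers_upto_def n)
  have fin: "finite Q" using finite_prime_powers_upto[of n] un by simp
  have "n * 2 ^ n = (\<Sum>(P, k) \<in> prime_powers_upto l. degree P * 2 ^ (n - k * degree P))
      + (\<Sum>(P, k) \<in> Q. degree P * 2 ^ (n - k * degree P))"
    unfolding sum_prime_powers_upto[symmetric] un
    by (rule sum.union_disjoint) (use fin dis finite_prime_powers_upto in auto)
  \<comment> \<open>Here k deg P \<le> \<open>l\<close>, so the truncated exponent really drops by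
    one from \<open>n\<close> to \<open>l\<close>.\<close>
  also have "(\<Sum>(P, k) \<in> prime_powers_upto l. degree P * 2 ^ (n - k * degree P)) =
     (\<Sum>(P, k) \<in> prime_powers_upto l. 2 * (degree P * 2 ^ (l - k * degree P)))"
    by (intro sum.cong) (auto simp: prime_powers_upto_def n Suc_diff_le)
  also have "\<dots> = 2 * (l * 2 ^ l)"
    unfolding sum_prime_powers_upto[symmetric] by (simp add: sum_distrib_left case_prod_unfold)
  also have "(\<Sum>(P, k) \<in> Q. degree P * 2 ^ (n - k * degree P)) = (\<Sum>(P, k) \<in> Q. degree P)"
    by (intro sum.cong) (auto simp: Q_def)
  finally show ?thesis by (simp add: n Q_def)
qed

section \<open>Bounds on the number of irreducible polynomials\<close>

definition irreducibles :: "nat \<Rightarrow> bit poly set" where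
  "irreducibles d = {P. irreducible P \<and> degree P = d}"

lemma finite_irreducibles: "finite (irreducibles d)"
  by (rule finite_subset[OF _ finite_polys_of_degree[of d]])
     (auto simp: irreducibles_def polys_of_degree_def)

text \<open>Only the pairs with k = 1 are kept in the sum of degrees. The bound serves to control
  the smaller degrees in the lower bound below.\<close>

lemma card_irreducibles_le:
  assumes "0 < d"
  shows "d * card (irreducibles d) \<le> 2 ^ d"
proof -
  let ?Q = "{(P :: bit poly, k). irreducible P \<and> 0 < k \<and> k * degree P = d}"
  have "finite ?Q"
    by (rule finite_subset[OF _ finite_prime_powers_upto[of d]]) (auto simp: prime_powers_upto_def)
  moreover have "(\<lambda>P. (P, 1)) ` irreducibles d \<subseteq> ?Q" by (auto simp: irreducibles_def)
  ultimately have "(\<Sum>(P, k) \<in> (\<lambda>P. (P, 1 :: nat)) ` irreducibles d. degree P) \<le> (\<Sum>(P, k) \<in> ?Q. degree P)"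
    by (intro sum_mono2) auto
  also have "(\<Sum>(P, k) \<in> (\<lambda>P. (P, 1 :: nat)) ` irreducibles d. degree P) = (\<Sum>P\<in>irreducibles d. degree P)"
    by (subst sum.reindex) (auto simp: inj_on_def)
  also have "\<dots> = (\<Sum>P\<in>irreducibles d. d)"
    by (intro sum.cong) (auto simp: irreducibles_def)
  finally show ?thesis using sum_prime_powers_of_degree[OF assms] by (simp add: mult.commute)
qed

text \<open>The sum of degrees over all (P, k) with k deg P = b is 2^b. The pairs with k > 1 have
  deg P at most b/2, so together they contribute at most the sum of 2^d over d \<le> b/2, which is
  at most half of 2^b.\<close>

lemma card_irreducibles_ge:
  assumes "0 < b"
  shows "2 ^ (b - 1) \<le> b * card (irreducibles b)"
proof -
  let ?Q = "{(P :: bit poly, k). irreducible P \<and> 0 < k \<and> k * degree P = b}"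
  let ?R = "{(P :: bit poly, k). irreducible P \<and> 1 < k \<and> k * degree P = b}"
  have finQ: "finite ?Q"
    by (rule finite_subset[OF _ finite_prime_powers_upto[of b]]) (auto simp: prime_powers_upto_def)
  then have finR: "finite ?R" by (rule rev_finite_subset) auto
  have Q: "?Q = (\<lambda>P. (P, 1)) ` irreducibles b \<union> ?R"
    by (auto simp: irreducibles_def image_iff)
  have "2 ^ b = (\<Sum>(P, k) \<in> (\<lambda>P. (P, 1 :: nat)) ` irreducibles b. degree P) + (\<Sum>(P, k) \<in> ?R. degree P)"
    unfolding sum_prime_powers_of_degree[OF assms, symmetric] Q
    by (rule sum.union_disjoint) (use finR finite_irreducibles in auto)
  also have "(\<Sum>(P, k) \<in> (\<lambda>P. (P, 1 :: nat)) ` irreducibles b. degree P) = (\<Sum>P\<in>irreducibles b. degree P)"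
    by (subst sum.reindex) (auto simp: inj_on_def)
  also have "\<dots> = (\<Sum>P\<in>irreducibles b. b)"
    by (intro sum.cong) (auto simp: irreducibles_def)
  also have "(\<Sum>(P, k) \<in> ?R. degree P) = (\<Sum>P \<in> fst ` ?R. degree P)"
  proof (subst sum.reindex)
    \<comment> \<open>For a given P the exponent is determined by \<open>k * degree P = b\<close>,
      because the degree is positive.\<close>
    show "inj_on fst ?R"
    proof (rule inj_onI)
      fix x y assume "x \<in> ?R" "y \<in> ?R" "fst x = fst y"
      then show "x = y" using irreducible_degree_pos[of "fst x"] by (cases x; cases y) auto
    qed
  qed (simp add: case_prod_unfold)
  also have "\<dots> \<le> (\<Sum>P \<in> (\<Union>d\<in>{1..b div 2}. irreducibles d). degree P)"
  proof (rule sum_mono2)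
    show "fst ` ?R \<subseteq> (\<Union>d\<in>{1..b div 2}. irreducibles d)"
    proof clarsimp
      fix P :: "bit poly" and k :: nat
      assume *: "irreducible P" "Suc 0 < k" "b = k * degree P"
      have "2 * degree P \<le> k * degree P" using * by (intro mult_right_mono) auto
      then have "degree P \<le> k * degree P div 2" by linarith
      then show "\<exists>d\<in>{Suc 0..k * degree P div 2}. P \<in> irreducibles d"
        using irreducible_degree_pos[OF *(1)] * by (auto simp: irreducibles_def)
    qed
  qed (auto simp: finite_irreducibles)
  also have "\<dots> = (\<Sum>d=1..b div 2. \<Sum>P\<in>irreducibles d. degree P)"
    by (rule sum.UNION_disjoint) (auto simp: finite_irreducibles, auto simp: irreducibles_def)
  also have "\<dots> = (\<Sum>d=1..b div 2. d * card (irreducibles d))"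
    by (intro sum.cong refl) (simp add: irreducibles_def)
  also have "\<dots> \<le> (\<Sum>d=1..b div 2. 2 ^ d)"
    by (intro sum_mono card_irreducibles_le) auto
  also have "\<dots> = 2 ^ (b div 2 + 1) - 2"
  proof -
    have "(\<Sum>d=1..m. 2 ^ d) + 2 = (2 :: nat) ^ (m + 1)" for m
      by (induction m) auto
    from this[of "b div 2"] show ?thesis by linarith
  qed
  also have "\<dots> \<le> 2 ^ (b - 1)"
  \<comment> \<open>For small b the comparison of exponents can fail and the subtracted 2 matters: b
    = 2 gives equality.\<close>
  proof (cases "b \<le> 3")
    case True
    then have "b = 1 \<or> b = 2 \<or> b = 3" using assms by auto
    then show ?thesis by auto
  next
    case False
    then have "(2 :: nat) ^ (b div 2 + 1) \<le> 2 ^ (b - 1)" by (intro power_increasing) auto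
    then show ?thesis by simp
  qed
  finally have "2 ^ b \<le> b * card (irreducibles b) + 2 ^ (b - 1)" by (simp add: mult.commute)
  moreover have "(2 :: nat) ^ b = 2 * 2 ^ (b - 1)" using assms by (cases b) auto
  ultimately show ?thesis by linarith
qed

section \<open>The LFSR hash family is AXU\<close>

lemma length_xor_bits [simp]: "length (x \<oplus>\<^sub>2 y) = min (length x) (length y)"
  by (simp add: xor_bits_def)

lemma nth_xor_bits [simp]:
  "i < length x \<Longrightarrow> i < length y \<Longrightarrow> (x \<oplus>\<^sub>2 y) ! i = x ! i + y ! i"
  by (simp add: xor_bits_def)

lemma bit_add_self [simp]: "a + a = 0" "a + (a + c) = c" for a c :: bit
  by (cases a; cases c; simp)+

lemma bits_eqI:
  fixes x y :: bits
  assumes "length x = b" "length y = b" "\<And>i. i < b \<Longrightarrow> x ! i = y ! i"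
  shows "x = y"
  using assms by (intro nth_equalityI) auto

text \<open>
  Stated for arbitrary semirings because the simplifier has its own normal form for sums and
  products of type \<^typ>\<open>bit\<close>.
\<close>

lemma sum_mult_add_right:
  fixes a f g :: "'i \<Rightarrow> 'a :: comm_semiring_0"
  shows "(\<Sum>i\<in>I. a i * (f i + g i)) = (\<Sum>i\<in>I. a i * f i) + (\<Sum>i\<in>I. a i * g i)"
  by (simp add: distrib_left sum.distrib)

lemma sum_mult_add_left:
  fixes a f g :: "'i \<Rightarrow> 'a :: comm_semiring_0"
  shows "(\<Sum>i\<in>I. (f i + g i) * a i) = (\<Sum>i\<in>I. f i * a i) + (\<Sum>i\<in>I. g i * a i)"
  by (simp add: distrib_right sum.distrib)

lemma xor_bits_self: "x \<oplus>\<^sub>2 x = replicate (length x) 0"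
  by (rule bits_eqI[where b = "length x"]) auto

lemma xor_bits_eq_zero_iff:
  assumes "length x = b" "length y = b"
  shows "x \<oplus>\<^sub>2 y = replicate b 0 \<longleftrightarrow> x = y"
proof
  assume *: "x \<oplus>\<^sub>2 y = replicate b 0"
  show "x = y"
  proof (rule bits_eqI[OF assms])
    fix i assume "i < b"
    then have "x ! i + y ! i = 0" using arg_cong[OF *, of "\<lambda>z. z ! i"] assms by simp
    then show "x ! i = y ! i" by (cases "x ! i"; cases "y ! i") auto
  qed
qed (use xor_bits_self assms in auto)

section \<open>The recurrence and its linearity in the initial state\<close>

lemma lfsr_less: "l < length p \<Longrightarrow> lfsr p s l = rev s ! l"
  by (simp add: lfsr.simps)

lemma lfsr_add_length:
  "lfsr p s (length p + l) = (\<Sum>i<length p. rev p ! i * lfsr p s (i + l))"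
  by (subst lfsr.simps) (simp add: add.commute)

text \<open>Each bit beyond the initial state is a fixed linear combination of earlier bits, so
  strong induction on the position applies.\<close>

lemma lfsr_xor:
  assumes "length s = length p" "length s' = length p"
  shows "lfsr p (s \<oplus>\<^sub>2 s') l = lfsr p s l + lfsr p s' l"
proof (induction l rule: less_induct)
  case (less l)
  show ?case
  proof (cases "l < length p")
    case True
    then show ?thesis using assms by (simp add: lfsr_less rev_nth)
  next
    case False
    define k where "k = l - length p"
    have l: "l = length p + k" using False by (simp add: k_def)
    have "lfsr p (s \<oplus>\<^sub>2 s') (i + k) = lfsr p s (i + k) + lfsr p s' (i + k)" if "i < length p" for i
      using less[of "i + k"] l that by simp
    then have "lfsr p (s \<oplus>\<^sub>2 s') l = (\<Sum>i<length p. rev p ! i * (lfsr p s (i + k) + lfsr p s' (i + k)))"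
      unfolding l lfsr_add_length by (intro sum.cong refl) (simp only: lessThan_iff)
    also have "\<dots> = lfsr p s l + lfsr p s' l"
      unfolding l lfsr_add_length by (rule sum_mult_add_right)
    finally show ?thesis .
  qed
qed

section \<open>The linear functional on polynomials that sends x^i to the register bit s_i\<close>

definition lfsr_functional :: "bits \<Rightarrow> bits \<Rightarrow> bit poly \<Rightarrow> bit" where
  "lfsr_functional p s g = (\<Sum>i\<le>degree g. coeff g i * lfsr p s i)"

text \<open>Any bound beyond which the coefficients vanish will do, so polynomials of different
  degrees can be summed over one range.\<close>

lemma lfsr_functional_eq:
  assumes "\<And>i. N < i \<Longrightarrow> coeff g i = 0"
  shows "lfsr_functional p s g = (\<Sum>i\<le>N. coeff g i * lfsr p s i)"
proof -
  have "lfsr_functional p s g = (\<Sum>i\<le>max N (degree g). coeff g i * lfsr p s i)"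
    unfolding lfsr_functional_def
    by (rule sum.mono_neutral_left) (auto simp: coeff_eq_0)
  also have "\<dots> = (\<Sum>i\<le>N. coeff g i * lfsr p s i)"
    using assms by (intro sum.mono_neutral_right) auto
  finally show ?thesis .
qed

lemma lfsr_functional_add:
  "lfsr_functional p s (f + g) = lfsr_functional p s f + lfsr_functional p s g"
proof -
  let ?N = "max (degree f) (degree g)"
  have "coeff f i = 0" "coeff g i = 0" if "?N < i" for i using that by (auto simp: coeff_eq_0)
  then have "lfsr_functional p s f = (\<Sum>i\<le>?N. coeff f i * lfsr p s i)"
    "lfsr_functional p s g = (\<Sum>i\<le>?N. coeff g i * lfsr p s i)"
    "lfsr_functional p s (f + g) = (\<Sum>i\<le>?N. (coeff f i + coeff g i) * lfsr p s i)"
    by (simp_all only: lfsr_functional_eq[of ?N] coeff_add add_0_left)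
  then show ?thesis by (simp only: sum_mult_add_left)
qed

lemma lfsr_functional_0 [simp]: "lfsr_functional p s 0 = 0"
  by (simp add: lfsr_functional_def)

lemma lfsr_functional_sum:
  "lfsr_functional p s (\<Sum>x\<in>A. f x) = (\<Sum>x\<in>A. lfsr_functional p s (f x))"
  by (induction A rule: infinite_finite_induct) (auto simp: lfsr_functional_add)

text \<open>Multiplication by x^j corresponds to shifting the register sequence by j.\<close>

lemma lfsr_functional_monom_mult:
  assumes "\<And>i. N < i \<Longrightarrow> coeff g i = 0"
  shows "lfsr_functional p s (monom 1 j * g) = (\<Sum>i\<le>N. coeff g i * lfsr p s (i + j))"
proof -
  have "lfsr_functional p s (monom 1 j * g) = (\<Sum>i\<le>N + j. coeff (monom 1 j * g) i * lfsr p s i)"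
    using assms by (intro lfsr_functional_eq) (auto simp: coeff_monom_mult)
  also have "\<dots> = (\<Sum>i\<in>{j..N + j}. coeff g (i - j) * lfsr p s i)"
    by (intro sum.mono_neutral_cong_right) (auto simp: coeff_monom_mult)
  also have "\<dots> = (\<Sum>i\<le>N. coeff g i * lfsr p s (i + j))"
    using sum.shift_bounds_cl_nat_ivl[of "\<lambda>i. coeff g (i - j) * lfsr p s i" 0 j N]
    by (simp add: atMost_atLeast0)
  finally show ?thesis .
qed

text \<open>A product is a sum of shifts x^j f with j \<le> \<open>degree g\<close>. The limit on j
  matters when only the shifts seen in the rows of a hash are known to vanish.\<close>

lemma lfsr_functional_mult_eq_0:
  assumes "\<And>j. j \<le> degree g \<Longrightarrow> lfsr_functional p s (monom 1 j * f) = 0"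
  shows "lfsr_functional p s (g * f) = 0"
proof -
  have "lfsr_functional p s (monom (coeff g j) j * f) = 0" if "j \<le> degree g" for j
    using assms[OF that] by (cases "coeff g j") auto
  moreover have "g * f = (\<Sum>j\<le>degree g. monom (coeff g j) j * f)"
    by (subst poly_as_sum_of_monoms[of g, symmetric]) (rule sum_distrib_right)
  ultimately show ?thesis by (simp add: lfsr_functional_sum)
qed

text \<open>The recurrence says exactly that the functional vanishes on x^j p(x) for every j; hence
  it vanishes on all multiples of p(x).\<close>

lemma lfsr_functional_connection_poly:
  "lfsr_functional p s (g * connection_poly p) = 0"
proof (rule lfsr_functional_mult_eq_0)
  fix j
  have "lfsr_functional p s (monom 1 j * connection_poly p) =
        (\<Sum>i\<le>length p. coeff (connection_poly p) i * lfsr p s (i + j))"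
    by (rule lfsr_functional_monom_mult) (simp add: coeff_connection_poly)
  also have "\<dots> = (\<Sum>i<length p. rev p ! i * lfsr p s (i + j)) + lfsr p s (length p + j)"
    by (simp add: coeff_connection_poly flip: lessThan_Suc_atMost)
  \<comment> \<open>By the recurrence the last term equals the sum before it, and a + a = 0 over
    GF(2).\<close>
  also have "\<dots> = 0" by (simp add: lfsr_add_length)
  finally show "lfsr_functional p s (monom 1 j * connection_poly p) = 0" .
qed

section \<open>The hash as values of the functional on shifts of the message polynomial\<close>

definition message_poly :: "bits \<Rightarrow> bit poly" where
  "message_poly m = (\<Sum>k<length m. monom (m ! k) k)"

lemma coeff_message_poly: "coeff (message_poly m) i = (if i < length m then m ! i else 0)"
proof -
  have "(\<Sum>k<length m. coeff (monom (m ! k) k) i) = (\<Sum>k<length m. if i = k then m ! k else 0)"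
    by (intro sum.cong) auto
  then show ?thesis by (simp add: message_poly_def coeff_sum)
qed

lemma message_poly_eq_0_iff: "message_poly m = 0 \<longleftrightarrow> m = replicate (length m) 0"
proof
  assume *: "message_poly m = 0"
  show "m = replicate (length m) 0"
  proof (rule bits_eqI[where b = "length m"])
    fix i assume "i < length m"
    then show "m ! i = replicate (length m) 0 ! i"
      using coeff_message_poly[of m i] * by simp
  qed auto
next
  assume *: "m = replicate (length m) 0"
  have "coeff (message_poly m) i = 0" for i
    using arg_cong[OF *, of "\<lambda>z. z ! i"] by (simp add: coeff_message_poly)
  then show "message_poly m = 0" by (simp add: poly_eq_iff)
qed

lemma degree_message_poly_le: "degree (message_poly m) \<le> length m"
  by (rule degree_le) (simp add: coeff_message_poly)

lemma length_lfsr_hash [simp]: "length (lfsr_hash p s m) = length p"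
  by (simp add: lfsr_hash_def)

lemma nth_lfsr_hash_eq_sum:
  assumes "i < length p"
  shows "lfsr_hash p s m ! i = (\<Sum>k<length m. m ! k * lfsr p s (k + (length p - 1 - i)))"
proof -
  have "lfsr_hash p s m ! i = (\<Sum>k<length m. lfsr_state p s k ! i * m ! k)"
    using assms by (simp add: lfsr_hash_def)
  also have "\<dots> = (\<Sum>k<length m. m ! k * lfsr p s (k + (length p - 1 - i)))"
    using assms by (intro sum.cong refl) (simp add: lfsr_state_def rev_nth add.commute conj_commute)
  finally show ?thesis .
qed

text \<open>States list the highest index first, so row i reads the sequence shifted by
  \<open>length p - 1 - i\<close>. Entry k of the message is the coefficient of x^k, without
  reversal.\<close>

lemma nth_lfsr_hash:
  assumes "i < length p"
  shows "lfsr_hash p s m ! i = lfsr_functional p s (monom 1 (length p - 1 - i) * message_poly m)"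
proof -
  have "lfsr_functional p s (monom 1 (length p - 1 - i) * message_poly m) =
     (\<Sum>k\<le>length m. coeff (message_poly m) k * lfsr p s (k + (length p - 1 - i)))"
    by (rule lfsr_functional_monom_mult) (simp add: coeff_message_poly)
  also have "\<dots> = (\<Sum>k<length m. m ! k * lfsr p s (k + (length p - 1 - i)))"
    by (simp add: coeff_message_poly flip: lessThan_Suc_atMost)
  finally show ?thesis using nth_lfsr_hash_eq_sum[OF assms] by simp
qed

text \<open>Linearity in the message, which reduces acceptance of a modified transmission to a
  condition on a difference of messages.\<close>

lemma lfsr_hash_xor_message:
  assumes "length m = length m'"
  shows "lfsr_hash p s (m \<oplus>\<^sub>2 m') = lfsr_hash p s m \<oplus>\<^sub>2 lfsr_hash p s m'"
proof (rule bits_eqI[where b = "length p"])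
  fix i assume i: "i < length p"
  let ?l = "\<lambda>k. lfsr p s (k + (length p - 1 - i))"
  have "lfsr_hash p s (m \<oplus>\<^sub>2 m') ! i = (\<Sum>k<length m. (m ! k + m' ! k) * ?l k)"
    unfolding nth_lfsr_hash_eq_sum[OF i] using assms by (intro sum.cong) (auto simp only: length_xor_bits nth_xor_bits lessThan_iff min.idem)
  also have "\<dots> = lfsr_hash p s m ! i + lfsr_hash p s m' ! i"
    unfolding nth_lfsr_hash_eq_sum[OF i] sum_mult_add_left assms ..
  finally show "lfsr_hash p s (m \<oplus>\<^sub>2 m') ! i = (lfsr_hash p s m \<oplus>\<^sub>2 lfsr_hash p s m') ! i"
    using i by simp
qed simp_all

text \<open>Linearity in the state, for comparing members of the family with the same connection
  polynomial.\<close>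

lemma lfsr_hash_xor_state:
  assumes "length s = length p" "length s' = length p"
  shows "lfsr_hash p (s \<oplus>\<^sub>2 s') m = lfsr_hash p s m \<oplus>\<^sub>2 lfsr_hash p s' m"
proof (rule bits_eqI[where b = "length p"])
  fix i assume i: "i < length p"
  then show "lfsr_hash p (s \<oplus>\<^sub>2 s') m ! i = (lfsr_hash p s m \<oplus>\<^sub>2 lfsr_hash p s' m) ! i"
    by (simp only: nth_xor_bits length_lfsr_hash nth_lfsr_hash_eq_sum lfsr_xor[OF assms] sum_mult_add_right)
qed simp_all

section \<open>Vanishing of the hash and divisibility\<close>

lemma finite_polys_degree_less: "finite {g :: bit poly. degree g < b}"
proof (rule finite_subset)
  show "{g :: bit poly. degree g < b} \<subseteq> insert 0 (\<Union>d<b. polys_of_degree d)"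
    by (auto simp: polys_of_degree_def)
qed (simp add: finite_polys_of_degree)

text \<open>Modulo an irreducible q that does not divide f, multiplication by f is injective on
  remainders; an injective map of a finite set to itself is surjective.\<close>

lemma irreducible_mult_mod_surj:
  fixes q f h :: "bit poly"
  assumes q: "irreducible q" and f: "\<not> q dvd f" and h: "degree h < degree q"
  obtains g where "degree g < degree q" "h = (g * f) mod q"
proof -
  let ?R = "{g. degree g < degree q}"
  have q0: "q \<noteq> 0" "0 < degree q" using q irreducible_degree_pos by auto
  have "inj_on (\<lambda>g. (g * f) mod q) ?R"
  proof (rule inj_onI, rule ccontr)
    fix g g' assume *: "g \<in> ?R" "g' \<in> ?R" "(g * f) mod q = (g' * f) mod q" "g \<noteq> g'"
    from *(3) have "q dvd (g - g') * f" by (simp add: mod_eq_dvd_iff algebra_simps)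
    then have "q dvd g - g'"
      using f field_poly_irreducible_imp_prime[OF q] prime_elem_dvd_multD by blast
    then have "degree q \<le> degree (g - g')" using *(4) by (intro dvd_imp_degree_le) auto
    moreover have "degree (g - g') < degree q" using * by (intro degree_diff_less) auto
    ultimately show False by simp
  qed
  moreover have "(\<lambda>g. (g * f) mod q) ` ?R \<subseteq> ?R"
  proof (rule image_subsetI)
    fix g
    \<comment> \<open>The zero remainder has \<open>degree\<close> 0 by convention; it belongs to
      \<open>?R\<close> because q has positive degree.\<close>
    show "(g * f) mod q \<in> ?R"
      using degree_mod_less[OF q0(1), of "g * f"] q0(2) by (cases "(g * f) mod q = 0") auto
  qed
  ultimately have "(\<lambda>g. (g * f) mod q) ` ?R = ?R"
    using endo_inj_surj finite_polys_degree_less by blast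
  then show thesis using that h by blast
qed

text \<open>If p(x) divides the message polynomial, the functional vanishes on all its shifts. If
  not, every x^i with i < \<open>length p\<close> is congruent to a multiple of the message
  polynomial; a zero hash then makes every initial bit 0, contrary to the choice of s.\<close>

lemma lfsr_hash_eq_0_iff:
  assumes q: "irreducible (connection_poly p)" and s: "length s = length p" "s \<noteq> replicate (length p) 0"
  shows "lfsr_hash p s m = replicate (length p) 0 \<longleftrightarrow> connection_poly p dvd message_poly m"
    (is "_ \<longleftrightarrow> ?q dvd ?m")
proof
  assume "?q dvd ?m"
  then obtain g where g: "?m = g * ?q" by (metis dvdE mult.commute)
  show "lfsr_hash p s m = replicate (length p) 0"
  proof (rule bits_eqI[where b = "length p"])
    fix i assume "i < length p"
    then show "lfsr_hash p s m ! i = replicate (length p) 0 ! i"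
      using lfsr_functional_connection_poly[of p s "monom 1 (length p - 1 - i) * g"]
      by (simp add: nth_lfsr_hash g mult.assoc)
  qed auto
next
  assume hash: "lfsr_hash p s m = replicate (length p) 0"
  have shift: "lfsr_functional p s (monom 1 j * ?m) = 0" if "j < length p" for j
    using nth_lfsr_hash[of "length p - 1 - j" p s m] that hash by simp
  show "?q dvd ?m"
  proof (rule ccontr)
    assume ndvd: "\<not> ?q dvd ?m"
    have "lfsr p s i = 0" if i: "i < length p" for i
    proof -
      have "degree (monom (1 :: bit) i) < degree ?q"
        using i by (simp add: degree_connection_poly degree_monom_eq)
      then obtain g where g: "degree g < degree ?q" "monom 1 i = (g * ?m) mod ?q"
        using irreducible_mult_mod_surj[OF q ndvd] by blast
      have "lfsr p s i = lfsr_functional p s (monom 1 i)"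
        using lfsr_functional_monom_mult[of 0 1 p s i] by simp
      \<comment> \<open>\<open>g\<close> has degree below \<open>length p\<close>, so only shifts
        that occur as rows of the hash are used.\<close>
      moreover have "lfsr_functional p s (g * ?m) = 0"
      proof (rule lfsr_functional_mult_eq_0)
        fix j assume "j \<le> degree g"
        with g(1) have "j < length p" by (simp add: degree_connection_poly)
        then show "lfsr_functional p s (monom 1 j * ?m) = 0" by (rule shift)
      qed
      moreover have "lfsr_functional p s (g * ?m) =
          lfsr_functional p s ((g * ?m) div ?q * ?q) + lfsr_functional p s ((g * ?m) mod ?q)"
        by (simp only: lfsr_functional_add[symmetric] div_mult_mod_eq)
      ultimately show ?thesis by (simp only: g(2) lfsr_functional_connection_poly add_0_left)
    qed
    then have "rev s ! i = 0" if "i < length p" for i using that by (simp add: lfsr_less)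
    then have "rev s = replicate (length p) 0"
      by (intro bits_eqI[where b = "length p"]) (use s in auto)
    then have "s = replicate (length p) 0" by (metis rev_replicate rev_rev_ident)
    with s show False by simp
  qed
qed

section \<open>Counting collisions in the family\<close>

definition axu_polys :: "nat \<Rightarrow> bits set" where
  "axu_polys b = {p. length p = b \<and> irreducible (connection_poly p)}"

definition axu_states :: "nat \<Rightarrow> bits set" where
  "axu_states b = {s. length s = b \<and> s \<noteq> replicate b 0}"

lemma axu_family_eq: "axu_family b = axu_polys b \<times> axu_states b"
  by (auto simp: axu_family_def axu_polys_def axu_states_def)

lemma card_axu_states: "card (axu_states b) = 2 ^ b - 1"
proof -
  have "axu_states b = {s. length s = b} - {replicate b 0}" by (auto simp: axu_states_def)
  then show ?thesis by (simp add: card_bit_strings finite_bit_strings)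
qed

lemma bij_betw_axu_polys: "bij_betw connection_poly (axu_polys b) (irreducibles b)"
proof (rule bij_betw_subset[OF bij_betw_connection_poly[of b]])
  show "connection_poly ` axu_polys b = irreducibles b"
  proof (intro equalityI subsetI)
    fix P assume P: "P \<in> irreducibles b"
    then have "P \<in> polys_of_degree b" by (auto simp: irreducibles_def polys_of_degree_def)
    then have "P \<in> connection_poly ` {p. length p = b}"
      by (simp only: bij_betw_imp_surj_on[OF bij_betw_connection_poly])
    then obtain p where "length p = b" "connection_poly p = P" by auto
    with P show "P \<in> connection_poly ` axu_polys b" by (auto simp: irreducibles_def axu_polys_def)
  qed (auto simp: axu_polys_def irreducibles_def degree_connection_poly)
qed (auto simp: axu_polys_def)

lemma card_axu_polys: "card (axu_polys b) = card (irreducibles b)"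
  using bij_betw_same_card[OF bij_betw_axu_polys] .

lemma finite_axu_polys: "finite (axu_polys b)"
  using bij_betw_finite[OF bij_betw_axu_polys] finite_irreducibles by blast

lemma finite_axu_states: "finite (axu_states b)"
  by (rule finite_subset[OF _ finite_bit_strings[of b]]) (auto simp: axu_states_def)

lemma finite_axu_family: "finite (axu_family b)"
  by (simp add: axu_family_eq finite_axu_polys finite_axu_states)

text \<open>\<open>pmf_of_set\<close> is the uniform distribution only for nonempty finite sets. The
  lower bound on irreducibles provides a polynomial, and 2^b - 1 > 0 a state.\<close>

lemma axu_family_nonempty:
  assumes "0 < b"
  shows "axu_family b \<noteq> {}"
proof -
  have "0 < b * card (irreducibles b)"
    using card_irreducibles_ge[OF assms] by (rule less_le_trans[rotated]) simp
  then have "axu_polys b \<noteq> {}" using card_axu_polys[of b] by auto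
  moreover have "(2 :: nat) ^ 1 \<le> 2 ^ b" using assms by (intro power_increasing) auto
  then have "axu_states b \<noteq> {}" using card_axu_states[of b] by auto
  ultimately show ?thesis by (auto simp: axu_family_eq)
qed

text \<open>The irreducible divisors are prime power divisors with k = 1, and the degrees of all
  prime power divisors sum to \<open>degree f\<close>.\<close>

lemma card_irreducible_divisors:
  assumes "f \<noteq> 0"
  shows "d * card {P \<in> irreducibles d. P dvd f} \<le> degree f"
proof -
  let ?D = "{P \<in> irreducibles d. P dvd f}"
  have "d * card ?D = (\<Sum>P\<in>?D. degree P)" by (simp add: irreducibles_def)
  also have "\<dots> = (\<Sum>(P, k) \<in> (\<lambda>P. (P, 1 :: nat)) ` ?D. degree P)"
    by (subst sum.reindex) (auto simp: inj_on_def)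
  also have "\<dots> \<le> (\<Sum>(P, k) \<in> prime_power_divisors f. degree P)"
    using finite_prime_power_divisors[OF assms]
    by (intro sum_mono2) (auto simp: prime_power_divisors_def irreducibles_def)
  also have "\<dots> = degree f" by (rule sum_degree_prime_power_divisors[OF assms])
  finally show ?thesis .
qed

text \<open>The probability bound with denominators cleared. For t = 0, p(x) must divide the message
  polynomial, which leaves few p, each with any state. For t \<noteq> 0, each p admits at most one
  state.\<close>

lemma card_axu_collisions:
  assumes b: "0 < b" and nz: "m \<noteq> replicate (length m) 0 \<or> t \<noteq> replicate b 0"
  shows "card {f \<in> axu_family b. lfsr_hash (fst f) (snd f) m = t} * 2 ^ (b - 1)
         \<le> length m * card (axu_family b)"
proof (cases "t = replicate b 0")
  case True
  let ?D = "{p \<in> axu_polys b. connection_poly p dvd message_poly m}"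
  have m: "message_poly m \<noteq> 0" using nz True message_poly_eq_0_iff by blast
  have "{f \<in> axu_family b. lfsr_hash (fst f) (snd f) m = t} \<subseteq> ?D \<times> axu_states b"
  proof (rule subrelI)
    fix p s assume "(p, s) \<in> {f \<in> axu_family b. lfsr_hash (fst f) (snd f) m = t}"
    then have *: "(p, s) \<in> axu_family b" "lfsr_hash p s m = t" by auto
    then have "irreducible (connection_poly p)" "length p = b" "length s = length p"
      "s \<noteq> replicate (length p) 0" by (auto simp: axu_family_def)
    with lfsr_hash_eq_0_iff[of p s m] *
    show "(p, s) \<in> ?D \<times> axu_states b"
      by (simp add: True axu_family_eq)
  qed
  then have "card {f \<in> axu_family b. lfsr_hash (fst f) (snd f) m = t} \<le> card (?D \<times> axu_states b)"
    by (intro card_mono finite_cartesian_product) (auto simp: finite_axu_polys finite_axu_states)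
  then have le: "card {f \<in> axu_family b. lfsr_hash (fst f) (snd f) m = t} \<le> card ?D * card (axu_states b)"
    by (simp only: card_cartesian_product)
  have "card ?D = card (connection_poly ` ?D)"
    by (rule card_image[symmetric], rule inj_on_subset[OF bij_betw_imp_inj_on[OF bij_betw_axu_polys[of b]]]) auto
  also have "\<dots> \<le> card {P \<in> irreducibles b. P dvd message_poly m}"
  proof (rule card_mono)
    show "finite {P \<in> irreducibles b. P dvd message_poly m}"
      using finite_irreducibles by simp
    show "connection_poly ` ?D \<subseteq> {P \<in> irreducibles b. P dvd message_poly m}"
      by (auto simp: axu_polys_def irreducibles_def degree_connection_poly)
  qed
  finally have "b * card ?D \<le> b * card {P \<in> irreducibles b. P dvd message_poly m}" by simp
  also have "\<dots> \<le> degree (message_poly m)" by (rule card_irreducible_divisors[OF m])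
  also have "\<dots> \<le> length m" by (rule degree_message_poly_le)
  finally have D: "b * card ?D \<le> length m" .
  \<comment> \<open>At most \<open>length m\<close> / b polynomials are bad and at least 2^(b - 1) /
    b exist; the factor b cancels.\<close>
  have "card ?D * 2 ^ (b - 1) \<le> card ?D * (b * card (axu_polys b))"
    using card_irreducibles_ge[OF b] by (simp add: card_axu_polys)
  also have "\<dots> = b * card ?D * card (axu_polys b)" by simp
  also have "\<dots> \<le> length m * card (axu_polys b)" using D by (rule mult_right_mono) simp
  finally have DP: "card ?D * 2 ^ (b - 1) \<le> length m * card (axu_polys b)" .
  have "card {f \<in> axu_family b. lfsr_hash (fst f) (snd f) m = t} * 2 ^ (b - 1)
      \<le> card ?D * card (axu_states b) * 2 ^ (b - 1)"
    using le by (rule mult_right_mono) simp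
  also have "\<dots> = card ?D * 2 ^ (b - 1) * card (axu_states b)" by (simp only: ac_simps)
  also have "\<dots> \<le> length m * card (axu_polys b) * card (axu_states b)"
    using DP by (rule mult_right_mono) simp
  finally show ?thesis by (simp add: axu_family_eq card_cartesian_product)
next
  case False
  let ?E = "{f \<in> axu_family b. lfsr_hash (fst f) (snd f) m = t}"
  have "inj_on fst ?E"
  proof (rule inj_onI, rule ccontr)
    fix x y assume "x \<in> ?E" "y \<in> ?E" "fst x = fst y" "x \<noteq> y"
    then obtain p s s' where *: "(p, s) \<in> axu_family b" "(p, s') \<in> axu_family b"
      "t = lfsr_hash p s m" "lfsr_hash p s' m = lfsr_hash p s m" "s \<noteq> s'"
      by (cases x; cases y) auto
    then have p: "irreducible (connection_poly p)" "length p = b" "length s = length p"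
      "length s' = length p" "s \<noteq> replicate (length p) 0" by (auto simp: axu_family_def)
    \<comment> \<open>Two states with the same hash differ by a nonzero state with zero hash, so
      p(x) divides the message polynomial and the common hash would be 0.\<close>
    have "s \<oplus>\<^sub>2 s' \<noteq> replicate (length p) 0" using xor_bits_eq_zero_iff[of s "length p" s'] p * by simp
    moreover have "lfsr_hash p (s \<oplus>\<^sub>2 s') m = replicate (length p) 0"
      using p * by (simp add: lfsr_hash_xor_state xor_bits_self)
    ultimately have "connection_poly p dvd message_poly m"
      using lfsr_hash_eq_0_iff[of p "s \<oplus>\<^sub>2 s'" m] p by simp
    then have "lfsr_hash p s m = replicate b 0" using lfsr_hash_eq_0_iff[of p s m] p by simp
    with * False show False by simp
  qed
  then have "card ?E = card (fst ` ?E)" by (simp add: card_image)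
  also have "\<dots> \<le> card (axu_polys b)"
    by (rule card_mono) (auto simp: finite_axu_polys axu_family_eq)
  finally have E: "card ?E \<le> card (axu_polys b)" .
  show ?thesis
  \<comment> \<open>The claimed bound is 0 for the empty message; its hash is zero, so it never
    equals t.\<close>
  proof (cases "m = []")
    case True
    have "lfsr_hash p s [] = replicate (length p) 0" for p s
      by (rule bits_eqI[where b = "length p"]) (auto simp: nth_lfsr_hash_eq_sum)
    then have "?E = {}" using False True by (auto simp: axu_family_def)
    then show ?thesis by (simp only: card.empty mult_0 le0)
  next
    case m: False
    \<comment> \<open>There are 2^b - 1 \<ge> 2^(b - 1) states, so one state per polynomial is a
      fraction of at most 2^(1 - b).\<close>
    have "(2 :: nat) ^ b = 2 ^ (b - 1) + 2 ^ (b - 1)" using b by (cases b) auto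
    moreover have "(1 :: nat) \<le> 2 ^ (b - 1)" by simp
    ultimately have "(2 :: nat) ^ (b - 1) \<le> card (axu_states b)"
      unfolding card_axu_states by linarith
    then have "card ?E * 2 ^ (b - 1) \<le> card (axu_polys b) * card (axu_states b)"
      using E by (intro mult_le_mono) auto
    also have "\<dots> \<le> length m * card (axu_family b)"
      using m by (cases m) (auto simp: axu_family_eq card_cartesian_product)
    finally show ?thesis .
  qed
qed

lemma prob_axu_collision:
  assumes b: "0 < b" and nz: "m \<noteq> replicate (length m) 0 \<or> t \<noteq> replicate b 0"
  shows "measure_pmf.prob (pmf_of_set (axu_family b)) {f. lfsr_hash (fst f) (snd f) m = t}
         \<le> real (length m) / 2 ^ (b - 1)"
proof -
  let ?E = "{f \<in> axu_family b. lfsr_hash (fst f) (snd f) m = t}"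
  have "measure_pmf.prob (pmf_of_set (axu_family b)) {f. lfsr_hash (fst f) (snd f) m = t}
      = real (card ?E) / real (card (axu_family b))"
    using axu_family_nonempty[OF b] finite_axu_family
    by (simp add: measure_pmf_of_set Int_def)
  also have "\<dots> \<le> real (length m) / 2 ^ (b - 1)"
  proof -
    have "0 < card (axu_family b)" using axu_family_nonempty[OF b] finite_axu_family
      by (simp add: card_gt_0_iff)
    moreover have "real (card ?E) * 2 ^ (b - 1) \<le> real (length m) * real (card (axu_family b))"
      using card_axu_collisions[OF b nz, THEN of_nat_mono[where 'a = real]] by simp
    ultimately show ?thesis by (simp add: field_simps)
  qed
  finally show ?thesis .
qed

section \<open>Random permutations\<close>

text \<open>The elements of M take distinct values in S one after another, the others take the
  remaining values of T in any order. Truncated subtraction makes the product 0 when S is too small.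
  The induction writes a permutation of T as a permutation p of T - {x} followed by the
  transposition of x and its image b.\<close>

lemma card_permutations_image_subset:
  assumes "finite T" "M \<subseteq> T" "S \<subseteq> T"
  shows "card {\<sigma>. \<sigma> permutes T \<and> \<sigma> ` M \<subseteq> S} =
         (\<Prod>i<card M. card S - i) * fact (card T - card M)"
proof -
  have "finite M" using assms finite_subset by blast
  then show ?thesis using assms
  proof (induction M arbitrary: S T rule: finite_induct)
    case empty
    then show ?case by (simp add: card_permutations)
  next
    case (insert x M)
    define T' where "T' = T - {x}"
    \<comment> \<open>The values allowed for p on M: the preimage of S under the transposition,
      which is its own inverse, without x, a value that p does not take on M.\<close>
    define U where "U b = Transposition.transpose x b ` S - {x}" for b
    define P where "P b = {p. p permutes T' \<and> p ` M \<subseteq> U b}" for b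
    have T: "T = insert x T'" "x \<notin> T'" "finite T'" "M \<subseteq> T'"
      using insert.hyps insert.prems by (auto simp: T'_def)
    have x_notin: "x \<notin> p ` M" if "p permutes T'" for p
    proof
      assume "x \<in> p ` M"
      then obtain y where y: "y \<in> M" "x = p y" by (elim imageE)
      then have "p y = p x" using permutes_not_in[OF that T(2)] by simp
      then have "y = x" by (rule injD[OF permutes_inj[OF that]])
      then show False using y insert.hyps by simp
    qed
    have step: "(Transposition.transpose x b \<circ> p) ` insert x M \<subseteq> S \<longleftrightarrow> b \<in> S \<and> p ` M \<subseteq> U b"
      if p: "p permutes T'" for b p
    proof -
      have px: "p x = x" by (rule permutes_not_in[OF p T(2)])
      have "Transposition.transpose x b (p y) \<in> S \<longleftrightarrow> p y \<in> Transposition.transpose x b ` S" for y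
        by (rule iffI, rule image_eqI[of _ _ "Transposition.transpose x b (p y)"]) auto
      then have "(Transposition.transpose x b \<circ> p) ` M \<subseteq> S \<longleftrightarrow> p ` M \<subseteq> Transposition.transpose x b ` S"
        by (simp only: image_subset_iff comp_apply)
      moreover have "p ` M \<subseteq> U b \<longleftrightarrow> p ` M \<subseteq> Transposition.transpose x b ` S"
        using x_notin[OF p] unfolding U_def by blast
      ultimately show ?thesis using px by simp
    qed
    have "{\<sigma>. \<sigma> permutes T \<and> \<sigma> ` insert x M \<subseteq> S} = (\<lambda>(b, p). Transposition.transpose x b \<circ> p) ` (SIGMA b:S. P b)"
    proof (intro equalityI subsetI)
      fix \<sigma> assume "\<sigma> \<in> {\<sigma>. \<sigma> permutes T \<and> \<sigma> ` insert x M \<subseteq> S}"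
      then have \<sigma>: "\<sigma> permutes insert x T'" "\<sigma> ` insert x M \<subseteq> S" using T by auto
      from \<sigma>(1) have "\<sigma> \<in> {p. p permutes insert x T'}" by simp
      then obtain b p where bp: "p permutes T'" "\<sigma> = Transposition.transpose x b \<circ> p"
        unfolding permutes_insert by auto
      then have "(b, p) \<in> (SIGMA b:S. P b)" using step[OF bp(1), of b] \<sigma> by (simp add: P_def)
      then show "\<sigma> \<in> (\<lambda>(b, p). Transposition.transpose x b \<circ> p) ` (SIGMA b:S. P b)"
        using bp by (intro image_eqI[of _ _ "(b, p)"]) auto
    next
      fix \<sigma> assume "\<sigma> \<in> (\<lambda>(b, p). Transposition.transpose x b \<circ> p) ` (SIGMA b:S. P b)"
      then obtain b p where bp: "\<sigma> = Transposition.transpose x b \<circ> p" "b \<in> S" "p permutes T'" "p ` M \<subseteq> U b"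
        by (auto simp: P_def)
      then have "\<sigma> \<in> {p. p permutes insert x T'}"
        unfolding permutes_insert using T insert.prems by auto
      then show "\<sigma> \<in> {\<sigma>. \<sigma> permutes T \<and> \<sigma> ` insert x M \<subseteq> S}"
        using step[OF bp(3), of b] bp T by simp
    qed
    moreover have "inj_on (\<lambda>(b, p). Transposition.transpose x b \<circ> p) (SIGMA b:S. P b)"
    proof (rule inj_onI, clarify)
      fix b p c r assume *: "p \<in> P b" "r \<in> P c" "Transposition.transpose x b \<circ> p = Transposition.transpose x c \<circ> r"
      then have "p x = x" "r x = x"
        by (intro permutes_not_in[OF _ T(2)]; simp add: P_def)+
      then have "b = c" using fun_cong[OF *(3), of x] by simp
      then have "Transposition.transpose x b \<circ> (Transposition.transpose x b \<circ> p) = Transposition.transpose x b \<circ> (Transposition.transpose x b \<circ> r)"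
        using *(3) by simp
      then have "p = r" by (simp add: fun_eq_iff)
      with \<open>b = c\<close> show "b = c \<and> p = r" by simp
    qed
    moreover have "finite S" using insert.prems finite_subset by blast
    moreover have "finite (P b)" for b
      using finite_permutations[OF T(3)] by (rule rev_finite_subset) (auto simp: P_def)
    ultimately have "card {\<sigma>. \<sigma> permutes T \<and> \<sigma> ` insert x M \<subseteq> S} = (\<Sum>b\<in>S. card (P b))"
      by (simp add: card_image)
    also have "\<dots> = (\<Sum>b\<in>S. (\<Prod>i<card M. (card S - 1) - i) * fact (card T' - card M))"
    proof (rule sum.cong[OF refl])
      fix b assume b: "b \<in> S"
      have "U b \<subseteq> T'"
        using b insert.prems by (auto simp: U_def T'_def Transposition.transpose_def split: if_splits)
      then have "card (P b) = (\<Prod>i<card M. card (U b) - i) * fact (card T' - card M)"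
        unfolding P_def using insert.IH T by simp
      \<comment> \<open>Removing x thus leaves card S - 1 values, whatever b in S was
        chosen.\<close>
      moreover have "x \<in> Transposition.transpose x b ` S" using b by (intro image_eqI[of _ _ b]) auto
      then have "card (U b) = card S - 1"
        by (simp add: U_def card_image \<open>finite S\<close>)
      ultimately show "card (P b) = (\<Prod>i<card M. (card S - 1) - i) * fact (card T' - card M)" by simp
    qed
    also have "\<dots> = card S * (\<Prod>i<card M. card S - Suc i) * fact (card T' - card M)" by simp
    also have "\<dots> = (\<Prod>i<card (insert x M). card S - i) * fact (card T - card (insert x M))"
      using insert.hyps T by (simp add: prod.lessThan_Suc_shift del: prod.lessThan_Suc)
    finally show ?case .
  qed
qed

text \<open>If \<gamma> avoids M on the first h positions, its inverse sends M into the last n - h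
  positions, and such inverses can be counted. Shrinking M to e + 1 elements only enlarges the
  event.\<close>

lemma prob_permutation_avoids:
  assumes "h \<le> n" and M: "M \<subseteq> {..<n}" "e < card M"
  shows "measure_pmf.prob (pmf_of_set {\<gamma>. \<gamma> permutes {..<n}}) {\<gamma>. \<forall>i<h. \<gamma> i \<notin> M}
         \<le> (\<Prod>i=0..e. (real (n - h) - real i) / (real n - real i))"
proof -
  define m where "m = Suc e"
  obtain M' where M': "M' \<subseteq> M" "card M' = m"
    using M(2) obtain_subset_with_card_n[of m M] by (metis Suc_leI m_def)
  then have M'n: "M' \<subseteq> {..<n}" using M by blast
  let ?all = "{\<gamma>. \<gamma> permutes {..<n}}"
  let ?E = "{\<gamma> \<in> ?all. \<forall>i<h. \<gamma> i \<notin> M}"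
  have finall: "finite ?all" by (simp add: finite_permutations)
  \<comment> \<open>The same count without a restriction on the images; the factor (n - m)! then
    cancels.\<close>
  have fact_n: "fact n = (\<Prod>i<m. n - i) * fact (n - m)"
  proof -
    have "{\<sigma>. \<sigma> permutes {..<n} \<and> \<sigma> ` M' \<subseteq> {..<n}} = ?all"
      using M'n by (auto simp: permutes_in_image subset_iff) (meson lessThan_iff permutes_in_image)
    then show ?thesis
      using card_permutations_image_subset[of "{..<n}" M' "{..<n}"] M'n M'(2)
      by (simp add: card_permutations)
  qed
  have "inv ` ?E \<subseteq> {\<sigma>. \<sigma> permutes {..<n} \<and> \<sigma> ` M' \<subseteq> {h..<n}}"
  proof (rule image_subsetI)
    fix \<gamma> assume \<gamma>: "\<gamma> \<in> ?E"
    then have p: "\<gamma> permutes {..<n}" by simp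
    have "inv \<gamma> y \<in> {h..<n}" if y: "y \<in> M'" for y
    proof -
      have "inv \<gamma> y < n" using permutes_in_image[OF permutes_inv[OF p]] y M'n by blast
      moreover have "\<gamma> (inv \<gamma> y) \<in> M" unfolding permutes_inverses(1)[OF p] using y M'(1) by blast
      then have "\<not> inv \<gamma> y < h" using \<gamma> by blast
      ultimately show ?thesis using \<open>h \<le> n\<close> by auto
    qed
    then show "inv \<gamma> \<in> {\<sigma>. \<sigma> permutes {..<n} \<and> \<sigma> ` M' \<subseteq> {h..<n}}"
      using permutes_inv[OF p] by blast
  qed
  moreover have "inj_on inv ?E"
    by (rule inj_onI) (metis (mono_tags, lifting) mem_Collect_eq permutes_inv_inv)
  ultimately have "card ?E \<le> card {\<sigma>. \<sigma> permutes {..<n} \<and> \<sigma> ` M' \<subseteq> {h..<n}}"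
    by (intro card_inj_on_le[of inv]) (auto intro: rev_finite_subset[OF finall])
  also have "\<dots> = (\<Prod>i<m. (n - h) - i) * fact (n - m)"
    using card_permutations_image_subset[of "{..<n}" M' "{h..<n}"] M'n M'(2)
    by (simp add: subset_eq)
  finally have E: "card ?E \<le> (\<Prod>i<m. (n - h) - i) * fact (n - m)" .
  have m_le: "m \<le> n" using card_mono[OF _ M'n] M'(2) by simp
  have "measure_pmf.prob (pmf_of_set ?all) {\<gamma>. \<forall>i<h. \<gamma> i \<notin> M} = real (card ?E) / real (fact n)"
  proof -
    have "id \<in> ?all" by (simp add: permutes_id)
    then have "?all \<noteq> {}" by blast
    then show ?thesis
      using finall by (simp add: measure_pmf_of_set Int_def card_permutations)
  qed
  also have "\<dots> \<le> real ((\<Prod>i<m. (n - h) - i) * fact (n - m)) / real (fact n)"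
    using E by (intro divide_right_mono of_nat_mono) auto
  also have "\<dots> = (\<Prod>i<m. real ((n - h) - i) / real (n - i))"
    unfolding fact_n by (simp add: prod_dividef)
  also have "\<dots> = (\<Prod>i<m. (real (n - h) - real i) / (real n - real i))"
  \<comment> \<open>Truncated and real differences agree as long as m \<le> n - h. Beyond that, both
    products contain the factor with i = n - h, which is 0.\<close>
  proof (cases "m \<le> n - h")
    case True
    then show ?thesis using m_le by (intro prod.cong refl) (simp add: of_nat_diff)
  next
    case False
    then have "n - h \<in> {..<m}" by simp
    then have "(\<Prod>i<m. real ((n - h) - i) / real (n - i)) = 0"
      "(\<Prod>i<m. (real (n - h) - real i) / (real n - real i)) = 0"
      by (intro prod_zero bexI[of _ "n - h"]; simp)+
    then show ?thesis by (rule trans[OF _ sym])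
  qed
  also have "{..<m} = {0..e}" by (auto simp: m_def)
  finally show ?thesis .
qed

section \<open>Tampering with a transmission\<close>

lemma set_pmf_uniform_bits [simp]: "set_pmf (uniform_bits b) = {x. length x = b}"
proof -
  have "replicate b 0 \<in> {x :: bits. length x = b}" by simp
  then show ?thesis unfolding uniform_bits_def
    by (intro set_pmf_of_set finite_bit_strings) blast
qed

lemma xor_bits_cancel: "length a = length x \<Longrightarrow> a \<oplus>\<^sub>2 (a \<oplus>\<^sub>2 x) = x"
  by (rule bits_eqI[where b = "length x"]) auto

text \<open>The one-time pad: XOR with a fixed string permutes the strings of its length and so
  preserves the uniform distribution.\<close>

lemma bind_uniform_bits_xor:
  assumes "length a = b"
  shows "bind_pmf (uniform_bits b) (\<lambda>x. F (a \<oplus>\<^sub>2 x)) = bind_pmf (uniform_bits b) F"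
proof -
  let ?B = "{x :: bits. length x = b}"
  have "bij_betw ((\<oplus>\<^sub>2) a) ?B ?B"
    by (rule bij_betwI[where g = "(\<oplus>\<^sub>2) a"]) (use assms xor_bits_cancel in auto)
  moreover have "?B \<noteq> {}" using Ex_list_of_length by blast
  ultimately have "map_pmf ((\<oplus>\<^sub>2) a) (uniform_bits b) = uniform_bits b"
    unfolding uniform_bits_def by (intro map_pmf_of_set_bij_betw finite_bit_strings)
  then have "bind_pmf (uniform_bits b) F = bind_pmf (map_pmf ((\<oplus>\<^sub>2) a) (uniform_bits b)) F" by simp
  also have "\<dots> = bind_pmf (uniform_bits b) (\<lambda>x. F (a \<oplus>\<^sub>2 x))" by (rule bind_map_pmf)
  finally show ?thesis by simp
qed

lemma prob_bind_pmf_le: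
  assumes "\<And>x. x \<in> set_pmf M \<Longrightarrow> measure_pmf.prob (N x) S \<le> \<epsilon>"
  shows "measure_pmf.prob (bind_pmf M N) S \<le> \<epsilon>"
proof -
  \<comment> \<open>\<open>ennreal\<close> maps negative reals to 0, so the sign is needed to return
    to reals. The support is nonempty, hence \<epsilon> bounds some probability.\<close>
  have "0 \<le> \<epsilon>" using assms set_pmf_not_empty[of M] measure_nonneg order_trans by (metis ex_in_conv)
  have "emeasure (bind_pmf M N) S = (\<integral>\<^sup>+x. emeasure (N x) S \<partial>M)" by simp
  also have "\<dots> \<le> (\<integral>\<^sup>+x. ennreal \<epsilon> \<partial>M)"
    using assms by (intro nn_integral_mono_AE) (simp add: AE_measure_pmf_iff measure_pmf.emeasure_eq_measure ennreal_leI)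
  also have "\<dots> = ennreal \<epsilon>" by simp
  finally show ?thesis
    using \<open>0 \<le> \<epsilon>\<close> by (simp add: measure_pmf.emeasure_eq_measure)
qed

lemma prob_bind_return_pmf:
  "measure_pmf.prob (bind_pmf M (\<lambda>x. return_pmf (g x))) S = measure_pmf.prob M {x. g x \<in> S}"
  by (simp add: map_pmf_def[symmetric] vimage_def)

section \<open>Forgery probabilities for one transmission\<close>

abbreviation hash :: "bits \<times> bits \<Rightarrow> bits \<Rightarrow> bits" where
  "hash f \<equiv> lfsr_hash (fst f) (snd f)"

text \<open>The key \<open>hash f m \<oplus>\<^sub>2 t\<close> is the one under which m has tag t.
  By linearity, the tag of m' under it depends on m only through the difference of the
  messages.\<close>

lemma wc_tag_shifted_key:
  assumes "length m = length m'" "length t = length (fst f)"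
  shows "wc_tag f (hash f m \<oplus>\<^sub>2 t) m' = hash f (m' \<oplus>\<^sub>2 m) \<oplus>\<^sub>2 t"
proof -
  have "hash f (m' \<oplus>\<^sub>2 m) = hash f m' \<oplus>\<^sub>2 hash f m"
    using assms by (intro lfsr_hash_xor_message) simp
  then show ?thesis unfolding wc_tag_def
    by (intro bits_eqI[where b = "length t"]) (use assms in \<open>auto simp: add.assoc\<close>)
qed

lemma set_pmf_axu_family:
  assumes "0 < b"
  shows "set_pmf (pmf_of_set (axu_family b)) = axu_family b"
  using axu_family_nonempty[OF assms] finite_axu_family by simp

lemma prob_forgery:
  assumes b: "0 < b" and len: "length m' = length m" "length t = b" "length t' = b"
    and ne: "(m', t') \<noteq> (m, t)"
  shows "measure_pmf.prob (pmf_of_set (axu_family b)) {f. hash f (m' \<oplus>\<^sub>2 m) = t' \<oplus>\<^sub>2 t}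
         \<le> real (length m) / 2 ^ (b - 1)"
proof -
  have "m' \<oplus>\<^sub>2 m \<noteq> replicate (length (m' \<oplus>\<^sub>2 m)) 0 \<or> t' \<oplus>\<^sub>2 t \<noteq> replicate b 0"
    using ne len xor_bits_eq_zero_iff[of m' "length m" m] xor_bits_eq_zero_iff[of t' b t] by auto
  from prob_axu_collision[OF b this] show ?thesis using len by simp
qed

lemma xor_bits_xor_right_cancel:
  "length t = length x \<Longrightarrow> (x \<oplus>\<^sub>2 t) \<oplus>\<^sub>2 t = x"
  by (rule bits_eqI[where b = "length x"]) (auto simp: add.assoc)

text \<open>Alice may send strings of any length, so the lengths are part of what the event implies.
  If one of them is wrong the event is impossible; otherwise it lies in the collision event.\<close>

lemma prob_event_le_forgery:
  assumes b: "0 < b" and len: "length t = b"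
    and ne: "(m', t') \<noteq> (m, t)"
    and E: "\<And>f. f \<in> axu_family b \<Longrightarrow> f \<in> E \<Longrightarrow> length m = l \<and> length m' = l \<and> t' = hash f (m' \<oplus>\<^sub>2 m) \<oplus>\<^sub>2 t"
  shows "measure_pmf.prob (pmf_of_set (axu_family b)) E \<le> real l / 2 ^ (b - 1)"
proof (cases "length m = l \<and> length m' = l \<and> length t' = b")
  case True
  have "measure_pmf.prob (pmf_of_set (axu_family b)) E
      \<le> measure_pmf.prob (pmf_of_set (axu_family b)) {f. hash f (m' \<oplus>\<^sub>2 m) = t' \<oplus>\<^sub>2 t}"
  proof (rule measure_pmf.finite_measure_mono_AE)
    have "hash f (m' \<oplus>\<^sub>2 m) = t' \<oplus>\<^sub>2 t" if "f \<in> axu_family b" "f \<in> E" for f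
    proof -
      have "length (fst f) = b" using that(1) by (auto simp: axu_family_def)
      then show ?thesis using E[OF that] len xor_bits_xor_right_cancel by simp
    qed
    then show "AE f in pmf_of_set (axu_family b). f \<in> E \<longrightarrow> f \<in> {f. hash f (m' \<oplus>\<^sub>2 m) = t' \<oplus>\<^sub>2 t}"
      by (simp add: AE_measure_pmf_iff set_pmf_axu_family[OF b])
  qed simp
  also have "\<dots> \<le> real l / 2 ^ (b - 1)" using prob_forgery[OF b _ len _ ne] True len by simp
  finally show ?thesis .
next
  case False
  have "measure_pmf.prob (pmf_of_set (axu_family b)) E
      \<le> measure_pmf.prob (pmf_of_set (axu_family b)) {}"
  proof (rule measure_pmf.finite_measure_mono_AE)
    \<comment> \<open>A tag of the wrong length is excluded too, since the string it must equal has
      length b.\<close>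
    have "f \<notin> E" if "f \<in> axu_family b" for f
    proof
      assume "f \<in> E"
      have "length (fst f) = b" using that(1) by (auto simp: axu_family_def)
      then show False using E[OF that \<open>f \<in> E\<close>] False len by auto
    qed
    then show "AE f in pmf_of_set (axu_family b). f \<in> E \<longrightarrow> f \<in> {}"
      by (simp add: AE_measure_pmf_iff set_pmf_axu_family[OF b])
  qed simp
  also have "\<dots> \<le> real l / 2 ^ (b - 1)" by simp
  finally show ?thesis .
qed

text \<open>These are the keys under which m is sent as (c, t). Decrypting c' yields a plaintext
  that differs from m by \<open>c' \<oplus>\<^sub>2 c\<close>, so m drops out of the check.\<close>

lemma secret_receive_shifted_keys:
  assumes "length m = l" "length c = l" "length t = length (fst f)"
  shows "secret_receive l f (hash f m \<oplus>\<^sub>2 t) (m \<oplus>\<^sub>2 c) (c', t') =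
     (if length c' = l \<and> t' = hash f (c' \<oplus>\<^sub>2 c) \<oplus>\<^sub>2 t then Some (c' \<oplus>\<^sub>2 (m \<oplus>\<^sub>2 c)) else None)"
proof (cases "length c' = l")
  case True
  have "(c' \<oplus>\<^sub>2 (m \<oplus>\<^sub>2 c)) \<oplus>\<^sub>2 m = c' \<oplus>\<^sub>2 c"
    by (rule bits_eqI[where b = l]) (use assms True in \<open>auto simp: ac_simps\<close>)
  then have "wc_tag f (hash f m \<oplus>\<^sub>2 t) (c' \<oplus>\<^sub>2 (m \<oplus>\<^sub>2 c)) = hash f (c' \<oplus>\<^sub>2 c) \<oplus>\<^sub>2 t"
    using wc_tag_shifted_key[of m "c' \<oplus>\<^sub>2 (m \<oplus>\<^sub>2 c)" t f] assms True by simp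
  then show ?thesis by (simp add: secret_receive_def)
qed (simp add: secret_receive_def)

lemma auth_receive_shifted_key:
  assumes "length m = l" "length t = length (fst f)"
  shows "auth_receive l f (hash f m \<oplus>\<^sub>2 t) (m', t') =
     (if length m' = l \<and> t' = hash f (m' \<oplus>\<^sub>2 m) \<oplus>\<^sub>2 t then Some m' else None)"
  using wc_tag_shifted_key[of m m' t f] assms by (auto simp: auth_receive_def)

lemma hash_xor_self: "hash f (m \<oplus>\<^sub>2 m) = replicate (length (fst f)) 0"
  using lfsr_hash_xor_message[of m m "fst f" "snd f"] by (simp add: xor_bits_self)

lemma zero_xor_bits: "length t = b \<Longrightarrow> replicate b 0 \<oplus>\<^sub>2 t = t"
  by (rule bits_eqI[where b = b]) auto

lemma secret_receive_untampered:
  assumes "length m = l" "length c = l" "length t = length (fst f)"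
  shows "secret_receive l f (hash f m \<oplus>\<^sub>2 t) (m \<oplus>\<^sub>2 c) (c, t) = Some m"
proof -
  have "c \<oplus>\<^sub>2 (m \<oplus>\<^sub>2 c) = m"
    by (rule bits_eqI[where b = l]) (use assms in \<open>auto simp: ac_simps\<close>)
  then show ?thesis
    using secret_receive_shifted_keys[OF assms] assms by (simp add: hash_xor_self zero_xor_bits)
qed

lemma secret_send_shifted_keys:
  assumes "length m = length c" "length t = length (fst f)"
  shows "secret_send f (hash f m \<oplus>\<^sub>2 t) (m \<oplus>\<^sub>2 c) m = (c, t)"
  using assms by (simp add: secret_send_def wc_tag_def xor_bits_cancel)

lemma auth_send_shifted_key:
  assumes "length t = length (fst f)"
  shows "auth_send f (hash f m \<oplus>\<^sub>2 t) m = (m, t)"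
  using assms by (simp add: auth_send_def wc_tag_def xor_bits_cancel)

section \<open>Kept key blocks\<close>

lemma length_block: "Suc j * w \<le> length X \<Longrightarrow> length (block w j X) = w"
  by (simp add: block_def)

lemma block_concat:
  assumes "\<forall>x\<in>set xs. length x = w" "i < length xs"
  shows "block w i (concat xs) = xs ! i"
  using assms by (induction xs arbitrary: i) (auto simp: block_def less_Suc_eq_0_disj)

context
  fixes n b\<^sub>H :: nat and X :: bits and \<gamma> :: "nat \<Rightarrow> nat"
  assumes X: "length X = n * (3 * b\<^sub>H)" and \<gamma>: "\<gamma> permutes {..<n}"
begin

lemma length_key_block:
  assumes "i < n div 2"
  shows "length (block (3 * b\<^sub>H) (\<gamma> i) X) = 3 * b\<^sub>H"
proof (rule length_block)
  have "\<gamma> i < n" using permutes_in_image[OF \<gamma>, of i] assms by auto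
  then show "Suc (\<gamma> i) * (3 * b\<^sub>H) \<le> length X" unfolding X by (intro mult_right_mono) auto
qed

lemma length_kept_blocks: "length (kept_blocks n b\<^sub>H X \<gamma>) = blocks_length n b\<^sub>H"
proof -
  have "length (kept_blocks n b\<^sub>H X \<gamma>) = (\<Sum>i\<leftarrow>[0..<n div 2]. length (block (3 * b\<^sub>H) (\<gamma> i) X))"
    by (simp add: kept_blocks_def length_concat comp_def)
  also have "\<dots> = (\<Sum>i\<leftarrow>[0..<n div 2]. 3 * b\<^sub>H)"
    by (intro arg_cong[where f = sum_list] map_cong refl) (auto intro: length_key_block)
  finally show ?thesis by (simp add: blocks_length_def sum_list_triv)
qed

lemma block_kept_blocks:
  assumes "i < n div 2"
  shows "block (3 * b\<^sub>H) i (kept_blocks n b\<^sub>H X \<gamma>) = block (3 * b\<^sub>H) (\<gamma> i) X"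
  unfolding kept_blocks_def using assms length_key_block
  by (subst block_concat) auto

end

section \<open>The game in terms of what is seen on the channel\<close>

text \<open>The deterministic rest of the game, with traffic and keys as separate arguments, so that
  the keys can be expressed through a given traffic.\<close>

definition final_outcome ::
  "nat \<Rightarrow> nat \<Rightarrow> nat \<Rightarrow> nat \<Rightarrow> (bits \<Rightarrow> nat list) \<Rightarrow> 'r alice \<Rightarrow> 'r \<Rightarrow> bits \<Rightarrow> bits \<Rightarrow>
   traffic \<Rightarrow> bits \<times> bits \<Rightarrow> bits \<Rightarrow> bits \<Rightarrow> bits \<Rightarrow> bits \<Rightarrow> bits \<Rightarrow> bits \<Rightarrow> bits \<Rightarrow> bits \<Rightarrow> bits \<Rightarrow> outcome" where
  "final_outcome n e\<^sub>m\<^sub>a\<^sub>x b\<^sub>M b\<^sub>H dec A \<omega> X\<^sub>B X\<^sub>C sent f k\<^sub>1 k\<^sub>2 k\<^sub>3 k\<^sub>4 k\<^sub>5 K\<^sub>1 K\<^sub>2 K\<^sub>3 K\<^sub>4 =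
   (let (d\<^sub>1, d\<^sub>2, d\<^sub>3, d\<^sub>4) = tamper_distribution A \<omega> X\<^sub>B X\<^sub>C sent in
    case (secret_receive (blocks_length n b\<^sub>H) f k\<^sub>1 K\<^sub>1 d\<^sub>1,
          secret_receive (positions_length n) f k\<^sub>2 K\<^sub>2 d\<^sub>2,
          secret_receive (blocks_length n b\<^sub>H) f k\<^sub>3 K\<^sub>3 d\<^sub>3,
          secret_receive (positions_length n) f k\<^sub>4 K\<^sub>4 d\<^sub>4) of
      (Some Y\<^sub>B, Some c\<^sub>B, Some Y\<^sub>C, Some c\<^sub>C) \<Rightarrow>
        messaging_outcome n e\<^sub>m\<^sub>a\<^sub>x b\<^sub>M b\<^sub>H X\<^sub>B X\<^sub>C (Y\<^sub>B, dec c\<^sub>B) (Y\<^sub>C, dec c\<^sub>C) f k\<^sub>5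
          (choose_pair A \<omega> X\<^sub>B X\<^sub>C sent) (tamper_forwarded A \<omega> X\<^sub>B X\<^sub>C sent)
    | _ \<Rightarrow> Aborted)"

lemma final_outcome_repudiated:
  assumes "final_outcome n e\<^sub>m\<^sub>a\<^sub>x b\<^sub>M b\<^sub>H dec A \<omega> X\<^sub>B X\<^sub>C sent f k\<^sub>1 k\<^sub>2 k\<^sub>3 k\<^sub>4 k\<^sub>5 K\<^sub>1 K\<^sub>2 K\<^sub>3 K\<^sub>4 = Accepted_by_Bob False"
    and "tamper_distribution A \<omega> X\<^sub>B X\<^sub>C sent = (d\<^sub>1, d\<^sub>2, d\<^sub>3, d\<^sub>4)"
  obtains Y\<^sub>B c\<^sub>B Y\<^sub>C c\<^sub>C where
    "secret_receive (blocks_length n b\<^sub>H) f k\<^sub>1 K\<^sub>1 d\<^sub>1 = Some Y\<^sub>B"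
    "secret_receive (positions_length n) f k\<^sub>2 K\<^sub>2 d\<^sub>2 = Some c\<^sub>B"
    "secret_receive (blocks_length n b\<^sub>H) f k\<^sub>3 K\<^sub>3 d\<^sub>3 = Some Y\<^sub>C"
    "secret_receive (positions_length n) f k\<^sub>4 K\<^sub>4 d\<^sub>4 = Some c\<^sub>C"
    "messaging_outcome n e\<^sub>m\<^sub>a\<^sub>x b\<^sub>M b\<^sub>H X\<^sub>B X\<^sub>C (Y\<^sub>B, dec c\<^sub>B) (Y\<^sub>C, dec c\<^sub>C) f k\<^sub>5
       (choose_pair A \<omega> X\<^sub>B X\<^sub>C sent) (tamper_forwarded A \<omega> X\<^sub>B X\<^sub>C sent) = Accepted_by_Bob False"
  using assms by (auto simp: final_outcome_def split: option.splits)

lemma messaging_outcome_repudiated: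
  assumes "messaging_outcome n e\<^sub>m\<^sub>a\<^sub>x b\<^sub>M b\<^sub>H X\<^sub>B X\<^sub>C (Y\<^sub>B, js\<^sub>B) (Y\<^sub>C, js\<^sub>C) f k (Doc, Sig) tamper = Accepted_by_Bob False"
  obtains m where "Bob_accepts n b\<^sub>M b\<^sub>H X\<^sub>B Y\<^sub>C js\<^sub>C Doc Sig"
    "auth_receive (b\<^sub>M + 4 * n * b\<^sub>H) f k (tamper (auth_send f k (Doc @ Sig))) = Some m"
    "e\<^sub>m\<^sub>a\<^sub>x < Charlie_mismatches n b\<^sub>H X\<^sub>C Y\<^sub>B js\<^sub>B (take b\<^sub>M m) (drop b\<^sub>M m)"
  using assms by (auto simp: messaging_outcome_def split: option.splits if_splits)

text \<open>
  The keys are recomputed from the ciphertexts \<open>c\<^sub>i\<close> and tags \<open>t\<^sub>i\<close> on the channel: the tag key is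
  \<open>f(m) \<oplus> t\<close> and the pad is \<open>m \<oplus> c\<close>.
\<close>

definition outcome_given_view ::
  "nat \<Rightarrow> nat \<Rightarrow> nat \<Rightarrow> nat \<Rightarrow> (nat list \<Rightarrow> bits) \<Rightarrow> (bits \<Rightarrow> nat list) \<Rightarrow> 'r alice \<Rightarrow> 'r \<Rightarrow> bits \<Rightarrow> bits \<Rightarrow>
   traffic \<times> bits \<Rightarrow> (nat \<Rightarrow> nat) \<times> (nat \<Rightarrow> nat) \<times> (bits \<times> bits) \<Rightarrow> outcome" where
  "outcome_given_view n e\<^sub>m\<^sub>a\<^sub>x b\<^sub>M b\<^sub>H enc dec A \<omega> X\<^sub>B X\<^sub>C =
   (\<lambda>(((c\<^sub>1, t\<^sub>1), (c\<^sub>2, t\<^sub>2), (c\<^sub>3, t\<^sub>3), (c\<^sub>4, t\<^sub>4)), t\<^sub>5) (\<gamma>\<^sub>B, \<gamma>\<^sub>C, f).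
     let m\<^sub>1 = kept_blocks n b\<^sub>H X\<^sub>B \<gamma>\<^sub>B; m\<^sub>2 = enc (map \<gamma>\<^sub>B [0..<n div 2]);
         m\<^sub>3 = kept_blocks n b\<^sub>H X\<^sub>C \<gamma>\<^sub>C; m\<^sub>4 = enc (map \<gamma>\<^sub>C [0..<n div 2]);
         sent = ((c\<^sub>1, t\<^sub>1), (c\<^sub>2, t\<^sub>2), (c\<^sub>3, t\<^sub>3), (c\<^sub>4, t\<^sub>4));
         m\<^sub>5 = fst (choose_pair A \<omega> X\<^sub>B X\<^sub>C sent) @ snd (choose_pair A \<omega> X\<^sub>B X\<^sub>C sent)
     in final_outcome n e\<^sub>m\<^sub>a\<^sub>x b\<^sub>M b\<^sub>H dec A \<omega> X\<^sub>B X\<^sub>C sent f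
          (hash f m\<^sub>1 \<oplus>\<^sub>2 t\<^sub>1) (hash f m\<^sub>2 \<oplus>\<^sub>2 t\<^sub>2) (hash f m\<^sub>3 \<oplus>\<^sub>2 t\<^sub>3) (hash f m\<^sub>4 \<oplus>\<^sub>2 t\<^sub>4) (hash f m\<^sub>5 \<oplus>\<^sub>2 t\<^sub>5)
          (m\<^sub>1 \<oplus>\<^sub>2 c\<^sub>1) (m\<^sub>2 \<oplus>\<^sub>2 c\<^sub>2) (m\<^sub>3 \<oplus>\<^sub>2 c\<^sub>3) (m\<^sub>4 \<oplus>\<^sub>2 c\<^sub>4))"

text \<open>For the fifth transmission only a tag is drawn: its message is public and chosen by
  Alice from what she has seen.\<close>

definition view_pmf :: "nat \<Rightarrow> nat \<Rightarrow> nat \<Rightarrow> (traffic \<times> bits) pmf" where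
  "view_pmf b\<^sub>H' l l' =
   do {
     t\<^sub>1 \<leftarrow> uniform_bits b\<^sub>H';
     t\<^sub>2 \<leftarrow> uniform_bits b\<^sub>H';
     t\<^sub>3 \<leftarrow> uniform_bits b\<^sub>H';
     t\<^sub>4 \<leftarrow> uniform_bits b\<^sub>H';
     c\<^sub>1 \<leftarrow> uniform_bits l;
     c\<^sub>2 \<leftarrow> uniform_bits l';
     c\<^sub>3 \<leftarrow> uniform_bits l;
     c\<^sub>4 \<leftarrow> uniform_bits l';
     t\<^sub>5 \<leftarrow> uniform_bits b\<^sub>H';
     return_pmf (((c\<^sub>1, t\<^sub>1), (c\<^sub>2, t\<^sub>2), (c\<^sub>3, t\<^sub>3), (c\<^sub>4, t\<^sub>4)), t\<^sub>5)
   }"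

definition secrets_pmf :: "nat \<Rightarrow> nat \<Rightarrow> ((nat \<Rightarrow> nat) \<times> (nat \<Rightarrow> nat) \<times> (bits \<times> bits)) pmf" where
  "secrets_pmf n b\<^sub>H' =
   do {
     \<gamma>\<^sub>B \<leftarrow> pmf_of_set {\<pi>. \<pi> permutes {..<n}};
     \<gamma>\<^sub>C \<leftarrow> pmf_of_set {\<pi>. \<pi> permutes {..<n}};
     f \<leftarrow> pmf_of_set (axu_family b\<^sub>H');
     return_pmf (\<gamma>\<^sub>B, \<gamma>\<^sub>C, f)
   }"

section \<open>Change of variables from the keys to the view\<close>

lemma set_pmf_permutations: "set_pmf (pmf_of_set {\<pi>. \<pi> permutes {..<n :: nat}}) = {\<pi>. \<pi> permutes {..<n}}"
proof (rule set_pmf_of_set)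
  have "id \<in> {\<pi>. \<pi> permutes {..<n}}" by (simp add: permutes_id)
  then show "{\<pi>. \<pi> permutes {..<n}} \<noteq> {}" by blast
qed (simp add: finite_permutations)

lemma length_axu_family: "f \<in> axu_family b \<Longrightarrow> length (fst f) = b"
  by (auto simp: axu_family_def)

text \<open>Every key is shifted by a string. The shift \<open>a\<^sub>5\<close> depends on the
  other draws, because Alice chooses the fifth message after seeing the first four
  transmissions.\<close>

lemma shift_channel_keys:
  assumes a1: "length a\<^sub>1 = b" and a2: "length a\<^sub>2 = b" and a3: "length a\<^sub>3 = b" and a4: "length a\<^sub>4 = b"
    and a5: "\<And>t\<^sub>1 t\<^sub>2 t\<^sub>3 t\<^sub>4 c\<^sub>1 c\<^sub>2 c\<^sub>3 c\<^sub>4. length (a\<^sub>5 t\<^sub>1 t\<^sub>2 t\<^sub>3 t\<^sub>4 c\<^sub>1 c\<^sub>2 c\<^sub>3 c\<^sub>4) = b"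
    and m1: "length m\<^sub>1 = l" and m2: "length m\<^sub>2 = l'" and m3: "length m\<^sub>3 = l" and m4: "length m\<^sub>4 = l'"
  shows
    "do {
       k\<^sub>1 \<leftarrow> uniform_bits b;
       k\<^sub>2 \<leftarrow> uniform_bits b;
       k\<^sub>3 \<leftarrow> uniform_bits b;
       k\<^sub>4 \<leftarrow> uniform_bits b;
       k\<^sub>5 \<leftarrow> uniform_bits b;
       K\<^sub>1 \<leftarrow> uniform_bits l;
       K\<^sub>2 \<leftarrow> uniform_bits l';
       K\<^sub>3 \<leftarrow> uniform_bits l;
       K\<^sub>4 \<leftarrow> uniform_bits l';
       G k\<^sub>1 k\<^sub>2 k\<^sub>3 k\<^sub>4 k\<^sub>5 K\<^sub>1 K\<^sub>2 K\<^sub>3 K\<^sub>4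
     } =
     do {
       t\<^sub>1 \<leftarrow> uniform_bits b;
       t\<^sub>2 \<leftarrow> uniform_bits b;
       t\<^sub>3 \<leftarrow> uniform_bits b;
       t\<^sub>4 \<leftarrow> uniform_bits b;
       c\<^sub>1 \<leftarrow> uniform_bits l;
       c\<^sub>2 \<leftarrow> uniform_bits l';
       c\<^sub>3 \<leftarrow> uniform_bits l;
       c\<^sub>4 \<leftarrow> uniform_bits l';
       t\<^sub>5 \<leftarrow> uniform_bits b;
       G (a\<^sub>1 \<oplus>\<^sub>2 t\<^sub>1) (a\<^sub>2 \<oplus>\<^sub>2 t\<^sub>2) (a\<^sub>3 \<oplus>\<^sub>2 t\<^sub>3) (a\<^sub>4 \<oplus>\<^sub>2 t\<^sub>4) (a\<^sub>5 t\<^sub>1 t\<^sub>2 t\<^sub>3 t\<^sub>4 c\<^sub>1 c\<^sub>2 c\<^sub>3 c\<^sub>4 \<oplus>\<^sub>2 t\<^sub>5)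
         (m\<^sub>1 \<oplus>\<^sub>2 c\<^sub>1) (m\<^sub>2 \<oplus>\<^sub>2 c\<^sub>2) (m\<^sub>3 \<oplus>\<^sub>2 c\<^sub>3) (m\<^sub>4 \<oplus>\<^sub>2 c\<^sub>4)
     }"
  apply (rule trans[OF bind_uniform_bits_xor[OF a1, symmetric]], rule bind_pmf_cong[OF refl])
  apply (rule trans[OF bind_uniform_bits_xor[OF a2, symmetric]], rule bind_pmf_cong[OF refl])
  apply (rule trans[OF bind_uniform_bits_xor[OF a3, symmetric]], rule bind_pmf_cong[OF refl])
  apply (rule trans[OF bind_uniform_bits_xor[OF a4, symmetric]], rule bind_pmf_cong[OF refl])
  \<comment> \<open>The draw of the fifth key is moved behind each pad in turn, so that it follows
    everything its shift depends on.\<close>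
  apply (rule trans[OF bind_commute_pmf])
  apply (rule trans[OF bind_uniform_bits_xor[OF m1, symmetric]], rule bind_pmf_cong[OF refl])
  apply (rule trans[OF bind_commute_pmf])
  apply (rule trans[OF bind_uniform_bits_xor[OF m2, symmetric]], rule bind_pmf_cong[OF refl])
  apply (rule trans[OF bind_commute_pmf])
  apply (rule trans[OF bind_uniform_bits_xor[OF m3, symmetric]], rule bind_pmf_cong[OF refl])
  apply (rule trans[OF bind_commute_pmf])
  apply (rule trans[OF bind_uniform_bits_xor[OF m4, symmetric]], rule bind_pmf_cong[OF refl])
  apply (rule bind_uniform_bits_xor[OF a5, symmetric])
  done

lemma position_code_permutation:
  assumes "position_code n enc dec" "\<gamma> permutes {..<n}"
  shows "length (enc (map \<gamma> [0..<n div 2])) = positions_length n"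
    and "dec (enc (map \<gamma> [0..<n div 2])) = map \<gamma> [0..<n div 2]"
proof -
  have "\<gamma> i < n" if "i < n div 2" for i
    using permutes_in_image[OF assms(2), of i] that by auto
  then have "length (map \<gamma> [0..<n div 2]) = n div 2 \<and> set (map \<gamma> [0..<n div 2]) \<subseteq> {..<n}" by auto
  then show "length (enc (map \<gamma> [0..<n div 2])) = positions_length n"
    and "dec (enc (map \<gamma> [0..<n div 2])) = map \<gamma> [0..<n div 2]"
    using assms(1) unfolding position_code_def by blast+
qed

text \<open>After the change of variables the distribution of the view does not involve the secrets,
  so the view can be drawn first and held fixed.\<close>

lemma repudiation_game_eq:
  assumes b: "0 < b\<^sub>H'" and code: "position_code n enc dec"
  shows "repudiation_game n e\<^sub>m\<^sub>a\<^sub>x b\<^sub>M b\<^sub>H b\<^sub>H' enc dec A =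
    do {
      \<omega> \<leftarrow> coins A;
      X\<^sub>B \<leftarrow> uniform_bits (n * (3 * b\<^sub>H));
      X\<^sub>C \<leftarrow> uniform_bits (n * (3 * b\<^sub>H));
      v \<leftarrow> view_pmf b\<^sub>H' (blocks_length n b\<^sub>H) (positions_length n);
      z \<leftarrow> secrets_pmf n b\<^sub>H';
      return_pmf (outcome_given_view n e\<^sub>m\<^sub>a\<^sub>x b\<^sub>M b\<^sub>H enc dec A \<omega> X\<^sub>B X\<^sub>C v z)
    }"
proof -
  let ?m1 = "\<lambda>X \<gamma>. kept_blocks n b\<^sub>H X \<gamma>"
  let ?m2 = "\<lambda>\<gamma>. enc (map \<gamma> [0..<n div 2])"
  let ?l = "blocks_length n b\<^sub>H" and ?l' = "positions_length n"
  have "repudiation_game n e\<^sub>m\<^sub>a\<^sub>x b\<^sub>M b\<^sub>H b\<^sub>H' enc dec A =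
    do {
      \<omega> \<leftarrow> coins A;
      X\<^sub>B \<leftarrow> uniform_bits (n * (3 * b\<^sub>H));
      X\<^sub>C \<leftarrow> uniform_bits (n * (3 * b\<^sub>H));
      \<gamma>\<^sub>B \<leftarrow> pmf_of_set {\<pi>. \<pi> permutes {..<n}};
      \<gamma>\<^sub>C \<leftarrow> pmf_of_set {\<pi>. \<pi> permutes {..<n}};
      f \<leftarrow> pmf_of_set (axu_family b\<^sub>H');
      k\<^sub>1 \<leftarrow> uniform_bits b\<^sub>H';
      k\<^sub>2 \<leftarrow> uniform_bits b\<^sub>H';
      k\<^sub>3 \<leftarrow> uniform_bits b\<^sub>H';
      k\<^sub>4 \<leftarrow> uniform_bits b\<^sub>H';
      k\<^sub>5 \<leftarrow> uniform_bits b\<^sub>H';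
      K\<^sub>1 \<leftarrow> uniform_bits ?l;
      K\<^sub>2 \<leftarrow> uniform_bits ?l';
      K\<^sub>3 \<leftarrow> uniform_bits ?l;
      K\<^sub>4 \<leftarrow> uniform_bits ?l';
      return_pmf (final_outcome n e\<^sub>m\<^sub>a\<^sub>x b\<^sub>M b\<^sub>H dec A \<omega> X\<^sub>B X\<^sub>C
        (secret_send f k\<^sub>1 K\<^sub>1 (?m1 X\<^sub>B \<gamma>\<^sub>B), secret_send f k\<^sub>2 K\<^sub>2 (?m2 \<gamma>\<^sub>B),
         secret_send f k\<^sub>3 K\<^sub>3 (?m1 X\<^sub>C \<gamma>\<^sub>C), secret_send f k\<^sub>4 K\<^sub>4 (?m2 \<gamma>\<^sub>C)) f k\<^sub>1 k\<^sub>2 k\<^sub>3 k\<^sub>4 k\<^sub>5 K\<^sub>1 K\<^sub>2 K\<^sub>3 K\<^sub>4)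
    }"
    unfolding repudiation_game_def final_outcome_def Let_def by (simp only: case_prod_unfold)
  also have "\<dots> =
    do {
      \<omega> \<leftarrow> coins A;
      X\<^sub>B \<leftarrow> uniform_bits (n * (3 * b\<^sub>H));
      X\<^sub>C \<leftarrow> uniform_bits (n * (3 * b\<^sub>H));
      \<gamma>\<^sub>B \<leftarrow> pmf_of_set {\<pi>. \<pi> permutes {..<n}};
      \<gamma>\<^sub>C \<leftarrow> pmf_of_set {\<pi>. \<pi> permutes {..<n}};
      f \<leftarrow> pmf_of_set (axu_family b\<^sub>H');
      v \<leftarrow> view_pmf b\<^sub>H' ?l ?l';
      return_pmf (outcome_given_view n e\<^sub>m\<^sub>a\<^sub>x b\<^sub>M b\<^sub>H enc dec A \<omega> X\<^sub>B X\<^sub>C v (\<gamma>\<^sub>B, \<gamma>\<^sub>C, f))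
    }"
  proof (intro bind_pmf_cong refl)
    fix \<omega> X\<^sub>B X\<^sub>C \<gamma>\<^sub>B \<gamma>\<^sub>C f
    assume "X\<^sub>B \<in> set_pmf (uniform_bits (n * (3 * b\<^sub>H)))" "X\<^sub>C \<in> set_pmf (uniform_bits (n * (3 * b\<^sub>H)))"
      and "\<gamma>\<^sub>B \<in> set_pmf (pmf_of_set {\<pi>. \<pi> permutes {..<n}})"
      and "\<gamma>\<^sub>C \<in> set_pmf (pmf_of_set {\<pi>. \<pi> permutes {..<n}})"
      and "f \<in> set_pmf (pmf_of_set (axu_family b\<^sub>H'))"
    then have X: "length X\<^sub>B = n * (3 * b\<^sub>H)" "length X\<^sub>C = n * (3 * b\<^sub>H)"
      and \<gamma>: "\<gamma>\<^sub>B permutes {..<n}" "\<gamma>\<^sub>C permutes {..<n}" and f: "length (fst f) = b\<^sub>H'"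
      by (simp_all add: set_pmf_permutations set_pmf_axu_family[OF b] length_axu_family)
    note len = length_kept_blocks[OF X(1) \<gamma>(1)] position_code_permutation(1)[OF code \<gamma>(1)]
      length_kept_blocks[OF X(2) \<gamma>(2)] position_code_permutation(1)[OF code \<gamma>(2)]
    have h: "length (hash f m) = b\<^sub>H'" for m using f by simp
    define m\<^sub>5 where "m\<^sub>5 sent = fst (choose_pair A \<omega> X\<^sub>B X\<^sub>C sent) @ snd (choose_pair A \<omega> X\<^sub>B X\<^sub>C sent)" for sent
    show "do {
      k\<^sub>1 \<leftarrow> uniform_bits b\<^sub>H';
      k\<^sub>2 \<leftarrow> uniform_bits b\<^sub>H';
      k\<^sub>3 \<leftarrow> uniform_bits b\<^sub>H';
      k\<^sub>4 \<leftarrow> uniform_bits b\<^sub>H';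
      k\<^sub>5 \<leftarrow> uniform_bits b\<^sub>H';
      K\<^sub>1 \<leftarrow> uniform_bits ?l;
      K\<^sub>2 \<leftarrow> uniform_bits ?l';
      K\<^sub>3 \<leftarrow> uniform_bits ?l;
      K\<^sub>4 \<leftarrow> uniform_bits ?l';
      return_pmf (final_outcome n e\<^sub>m\<^sub>a\<^sub>x b\<^sub>M b\<^sub>H dec A \<omega> X\<^sub>B X\<^sub>C
        (secret_send f k\<^sub>1 K\<^sub>1 (?m1 X\<^sub>B \<gamma>\<^sub>B), secret_send f k\<^sub>2 K\<^sub>2 (?m2 \<gamma>\<^sub>B),
         secret_send f k\<^sub>3 K\<^sub>3 (?m1 X\<^sub>C \<gamma>\<^sub>C), secret_send f k\<^sub>4 K\<^sub>4 (?m2 \<gamma>\<^sub>C)) f k\<^sub>1 k\<^sub>2 k\<^sub>3 k\<^sub>4 k\<^sub>5 K\<^sub>1 K\<^sub>2 K\<^sub>3 K\<^sub>4)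
      } =
      do {
        v \<leftarrow> view_pmf b\<^sub>H' ?l ?l';
        return_pmf (outcome_given_view n e\<^sub>m\<^sub>a\<^sub>x b\<^sub>M b\<^sub>H enc dec A \<omega> X\<^sub>B X\<^sub>C v (\<gamma>\<^sub>B, \<gamma>\<^sub>C, f))
      }"
      unfolding view_pmf_def bind_assoc_pmf bind_return_pmf
      by (rule trans[OF shift_channel_keys[where a\<^sub>1 = "hash f (?m1 X\<^sub>B \<gamma>\<^sub>B)" and a\<^sub>2 = "hash f (?m2 \<gamma>\<^sub>B)"
              and a\<^sub>3 = "hash f (?m1 X\<^sub>C \<gamma>\<^sub>C)" and a\<^sub>4 = "hash f (?m2 \<gamma>\<^sub>C)"
              and a\<^sub>5 = "\<lambda>t\<^sub>1 t\<^sub>2 t\<^sub>3 t\<^sub>4 c\<^sub>1 c\<^sub>2 c\<^sub>3 c\<^sub>4. hash f (m\<^sub>5 ((c\<^sub>1, t\<^sub>1), (c\<^sub>2, t\<^sub>2), (c\<^sub>3, t\<^sub>3), (c\<^sub>4, t\<^sub>4)))",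
              OF h h h h h len]])
         (intro bind_pmf_cong refl,
          simp add: outcome_given_view_def Let_def m\<^sub>5_def secret_send_shifted_keys len f)
  qed
  also have "\<dots> =
    do {
      \<omega> \<leftarrow> coins A;
      X\<^sub>B \<leftarrow> uniform_bits (n * (3 * b\<^sub>H));
      X\<^sub>C \<leftarrow> uniform_bits (n * (3 * b\<^sub>H));
      z \<leftarrow> secrets_pmf n b\<^sub>H';
      v \<leftarrow> view_pmf b\<^sub>H' ?l ?l';
      return_pmf (outcome_given_view n e\<^sub>m\<^sub>a\<^sub>x b\<^sub>M b\<^sub>H enc dec A \<omega> X\<^sub>B X\<^sub>C v z)
    }"
    unfolding secrets_pmf_def bind_assoc_pmf bind_return_pmf ..
  finally show ?thesis
    by (simp only: bind_commute_pmf[of "secrets_pmf n b\<^sub>H'"])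
qed

section \<open>Security against repudiation\<close>

lemma prob_outcome_given_view_le:
  fixes A :: "'r alice"
  assumes n: "even n" "0 < n" and b: "0 < b\<^sub>H'" and code: "position_code n enc dec"
    and pos: "positions_length n \<le> b\<^sub>M + 4 * n * b\<^sub>H"
    and X\<^sub>B: "length X\<^sub>B = n * (3 * b\<^sub>H)" and X\<^sub>C: "length X\<^sub>C = n * (3 * b\<^sub>H)"
    and v: "v \<in> set_pmf (view_pmf b\<^sub>H' (blocks_length n b\<^sub>H) (positions_length n))"
  shows "measure_pmf.prob
      (do {
         z \<leftarrow> secrets_pmf n b\<^sub>H';
         return_pmf (outcome_given_view n e\<^sub>m\<^sub>a\<^sub>x b\<^sub>M b\<^sub>H enc dec A \<omega> X\<^sub>B X\<^sub>C v z)
       }) {Accepted_by_Bob False}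
    \<le> max (\<Prod>i = 0..e\<^sub>m\<^sub>a\<^sub>x. (real n / 2 - real i) / (real n - real i))
           (real (b\<^sub>M + 4 * n * b\<^sub>H) / 2 ^ (b\<^sub>H' - 1))"
    (is "measure_pmf.prob ?game ?rep \<le> max ?guess ?forge")
proof -
  let ?perms = "pmf_of_set {\<pi>. \<pi> permutes {..<n}}"
  let ?axu = "pmf_of_set (axu_family b\<^sub>H')"
  let ?l = "blocks_length n b\<^sub>H" and ?l' = "positions_length n" and ?L = "b\<^sub>M + 4 * n * b\<^sub>H"
  obtain c\<^sub>1 t\<^sub>1 c\<^sub>2 t\<^sub>2 c\<^sub>3 t\<^sub>3 c\<^sub>4 t\<^sub>4 t\<^sub>5 where v_eq: "v = (((c\<^sub>1, t\<^sub>1), (c\<^sub>2, t\<^sub>2), (c\<^sub>3, t\<^sub>3), (c\<^sub>4, t\<^sub>4)), t\<^sub>5)"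
    by (metis prod.exhaust)
  have t: "length t\<^sub>1 = b\<^sub>H'" "length t\<^sub>2 = b\<^sub>H'" "length t\<^sub>3 = b\<^sub>H'" "length t\<^sub>4 = b\<^sub>H'" "length t\<^sub>5 = b\<^sub>H'"
    and c: "length c\<^sub>1 = ?l" "length c\<^sub>2 = ?l'" "length c\<^sub>3 = ?l" "length c\<^sub>4 = ?l'"
    using v by (auto simp: v_eq view_pmf_def)
  define sent where "sent = ((c\<^sub>1, t\<^sub>1), (c\<^sub>2, t\<^sub>2), (c\<^sub>3, t\<^sub>3), (c\<^sub>4, t\<^sub>4))"
  obtain Doc Sig where pair: "choose_pair A \<omega> X\<^sub>B X\<^sub>C sent = (Doc, Sig)" by (metis prod.exhaust)
  obtain c\<^sub>1' t\<^sub>1' c\<^sub>2' t\<^sub>2' c\<^sub>3' t\<^sub>3' c\<^sub>4' t\<^sub>4'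
    where tampered: "tamper_distribution A \<omega> X\<^sub>B X\<^sub>C sent = ((c\<^sub>1', t\<^sub>1'), (c\<^sub>2', t\<^sub>2'), (c\<^sub>3', t\<^sub>3'), (c\<^sub>4', t\<^sub>4'))"
    by (metis prod.exhaust)
  obtain m' t\<^sub>5' where forwarded: "tamper_forwarded A \<omega> X\<^sub>B X\<^sub>C sent (Doc @ Sig, t\<^sub>5) = (m', t\<^sub>5')"
    by (metis prod.exhaust)
  define H where "H \<gamma>\<^sub>B \<gamma>\<^sub>C f = outcome_given_view n e\<^sub>m\<^sub>a\<^sub>x b\<^sub>M b\<^sub>H enc dec A \<omega> X\<^sub>B X\<^sub>C v (\<gamma>\<^sub>B, \<gamma>\<^sub>C, f)" for \<gamma>\<^sub>B \<gamma>\<^sub>C f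
  have game: "?game = do { \<gamma>\<^sub>B \<leftarrow> ?perms; \<gamma>\<^sub>C \<leftarrow> ?perms; f \<leftarrow> ?axu; return_pmf (H \<gamma>\<^sub>B \<gamma>\<^sub>C f) }"
    unfolding H_def secrets_pmf_def bind_assoc_pmf bind_return_pmf ..
  define m\<^sub>1 where "m\<^sub>1 \<gamma>\<^sub>B = kept_blocks n b\<^sub>H X\<^sub>B \<gamma>\<^sub>B" for \<gamma>\<^sub>B
  define m\<^sub>3 where "m\<^sub>3 \<gamma>\<^sub>C = kept_blocks n b\<^sub>H X\<^sub>C \<gamma>\<^sub>C" for \<gamma>\<^sub>C
  define ps where "ps \<gamma> = enc (map \<gamma> [0..<n div 2])" for \<gamma>

  \<comment> \<open>What a repudiation forces for a fixed view: five conditions in which f is the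
    only secret and, without tampering, the verdicts of both users on the original pair.\<close>
  have repudiated:
    "(length c\<^sub>1' = ?l \<and> t\<^sub>1' = hash f (c\<^sub>1' \<oplus>\<^sub>2 c\<^sub>1) \<oplus>\<^sub>2 t\<^sub>1) \<and>
     (length c\<^sub>2' = ?l' \<and> t\<^sub>2' = hash f (c\<^sub>2' \<oplus>\<^sub>2 c\<^sub>2) \<oplus>\<^sub>2 t\<^sub>2) \<and>
     (length c\<^sub>3' = ?l \<and> t\<^sub>3' = hash f (c\<^sub>3' \<oplus>\<^sub>2 c\<^sub>3) \<oplus>\<^sub>2 t\<^sub>3) \<and>
     (length c\<^sub>4' = ?l' \<and> t\<^sub>4' = hash f (c\<^sub>4' \<oplus>\<^sub>2 c\<^sub>4) \<oplus>\<^sub>2 t\<^sub>4) \<and>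
     (length (Doc @ Sig) = ?L \<and> length m' = ?L \<and> t\<^sub>5' = hash f (m' \<oplus>\<^sub>2 (Doc @ Sig)) \<oplus>\<^sub>2 t\<^sub>5) \<and>
     (tamper_distribution A \<omega> X\<^sub>B X\<^sub>C sent = sent \<longrightarrow> m' = Doc @ Sig \<longrightarrow>
        Bob_accepts n b\<^sub>M b\<^sub>H X\<^sub>B (m\<^sub>3 \<gamma>\<^sub>C) (map \<gamma>\<^sub>C [0..<n div 2]) Doc Sig \<and>
        e\<^sub>m\<^sub>a\<^sub>x < Charlie_mismatches n b\<^sub>H X\<^sub>C (m\<^sub>1 \<gamma>\<^sub>B) (map \<gamma>\<^sub>B [0..<n div 2]) Doc Sig)"
    if f: "f \<in> axu_family b\<^sub>H'" and \<gamma>: "\<gamma>\<^sub>B permutes {..<n}" "\<gamma>\<^sub>C permutes {..<n}"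
      and rep: "H \<gamma>\<^sub>B \<gamma>\<^sub>C f = Accepted_by_Bob False" for \<gamma>\<^sub>B \<gamma>\<^sub>C f
  proof -
    have lf: "length (fst f) = b\<^sub>H'" using f by (rule length_axu_family)
    have lm: "length (m\<^sub>1 \<gamma>\<^sub>B) = ?l" "length (ps \<gamma>\<^sub>B) = ?l'" "length (m\<^sub>3 \<gamma>\<^sub>C) = ?l" "length (ps \<gamma>\<^sub>C) = ?l'"
      unfolding m\<^sub>1_def m\<^sub>3_def ps_def
      using length_kept_blocks X\<^sub>B X\<^sub>C \<gamma> position_code_permutation(1)[OF code] by blast+
    let ?k = "\<lambda>m t. hash f m \<oplus>\<^sub>2 t"
    have "final_outcome n e\<^sub>m\<^sub>a\<^sub>x b\<^sub>M b\<^sub>H dec A \<omega> X\<^sub>B X\<^sub>C sent f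
        (?k (m\<^sub>1 \<gamma>\<^sub>B) t\<^sub>1) (?k (ps \<gamma>\<^sub>B) t\<^sub>2) (?k (m\<^sub>3 \<gamma>\<^sub>C) t\<^sub>3) (?k (ps \<gamma>\<^sub>C) t\<^sub>4) (?k (Doc @ Sig) t\<^sub>5)
        (m\<^sub>1 \<gamma>\<^sub>B \<oplus>\<^sub>2 c\<^sub>1) (ps \<gamma>\<^sub>B \<oplus>\<^sub>2 c\<^sub>2) (m\<^sub>3 \<gamma>\<^sub>C \<oplus>\<^sub>2 c\<^sub>3) (ps \<gamma>\<^sub>C \<oplus>\<^sub>2 c\<^sub>4) = Accepted_by_Bob False"
      using rep pair by (simp add: H_def v_eq outcome_given_view_def Let_def sent_def m\<^sub>1_def m\<^sub>3_def ps_def)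
    from final_outcome_repudiated[OF this tampered] obtain Y\<^sub>B p\<^sub>B Y\<^sub>C p\<^sub>C where
      r: "secret_receive ?l f (?k (m\<^sub>1 \<gamma>\<^sub>B) t\<^sub>1) (m\<^sub>1 \<gamma>\<^sub>B \<oplus>\<^sub>2 c\<^sub>1) (c\<^sub>1', t\<^sub>1') = Some Y\<^sub>B"
         "secret_receive ?l' f (?k (ps \<gamma>\<^sub>B) t\<^sub>2) (ps \<gamma>\<^sub>B \<oplus>\<^sub>2 c\<^sub>2) (c\<^sub>2', t\<^sub>2') = Some p\<^sub>B"
         "secret_receive ?l f (?k (m\<^sub>3 \<gamma>\<^sub>C) t\<^sub>3) (m\<^sub>3 \<gamma>\<^sub>C \<oplus>\<^sub>2 c\<^sub>3) (c\<^sub>3', t\<^sub>3') = Some Y\<^sub>C"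
         "secret_receive ?l' f (?k (ps \<gamma>\<^sub>C) t\<^sub>4) (ps \<gamma>\<^sub>C \<oplus>\<^sub>2 c\<^sub>4) (c\<^sub>4', t\<^sub>4') = Some p\<^sub>C"
      and mo: "messaging_outcome n e\<^sub>m\<^sub>a\<^sub>x b\<^sub>M b\<^sub>H X\<^sub>B X\<^sub>C (Y\<^sub>B, dec p\<^sub>B) (Y\<^sub>C, dec p\<^sub>C) f (?k (Doc @ Sig) t\<^sub>5)
           (Doc, Sig) (tamper_forwarded A \<omega> X\<^sub>B X\<^sub>C sent) = Accepted_by_Bob False"
      unfolding pair .
    have d: "length c\<^sub>1' = ?l \<and> t\<^sub>1' = hash f (c\<^sub>1' \<oplus>\<^sub>2 c\<^sub>1) \<oplus>\<^sub>2 t\<^sub>1" "length c\<^sub>2' = ?l' \<and> t\<^sub>2' = hash f (c\<^sub>2' \<oplus>\<^sub>2 c\<^sub>2) \<oplus>\<^sub>2 t\<^sub>2"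
      "length c\<^sub>3' = ?l \<and> t\<^sub>3' = hash f (c\<^sub>3' \<oplus>\<^sub>2 c\<^sub>3) \<oplus>\<^sub>2 t\<^sub>3" "length c\<^sub>4' = ?l' \<and> t\<^sub>4' = hash f (c\<^sub>4' \<oplus>\<^sub>2 c\<^sub>4) \<oplus>\<^sub>2 t\<^sub>4"
      using r unfolding secret_receive_shifted_keys[OF lm(1) c(1) t(1)[folded lf]]
        secret_receive_shifted_keys[OF lm(2) c(2) t(2)[folded lf]]
        secret_receive_shifted_keys[OF lm(3) c(3) t(3)[folded lf]]
        secret_receive_shifted_keys[OF lm(4) c(4) t(4)[folded lf]]
      by (simp_all only: split: if_splits) simp_all
    have "tamper_forwarded A \<omega> X\<^sub>B X\<^sub>C sent (auth_send f (?k (Doc @ Sig) t\<^sub>5) (Doc @ Sig)) = (m', t\<^sub>5')"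
      using auth_send_shifted_key[of t\<^sub>5 f "Doc @ Sig"] t(5) lf forwarded by simp
    from messaging_outcome_repudiated[OF mo, unfolded this] obtain m where
      Bob: "Bob_accepts n b\<^sub>M b\<^sub>H X\<^sub>B Y\<^sub>C (dec p\<^sub>C) Doc Sig"
      and recv: "auth_receive ?L f (?k (Doc @ Sig) t\<^sub>5) (m', t\<^sub>5') = Some m"
      and Charlie: "e\<^sub>m\<^sub>a\<^sub>x < Charlie_mismatches n b\<^sub>H X\<^sub>C Y\<^sub>B (dec p\<^sub>B) (take b\<^sub>M m) (drop b\<^sub>M m)" .
    \<comment> \<open>Bob's acceptance fixes the lengths, so cutting \<open>Doc @ Sig\<close> at
      \<open>b\<^sub>M\<close> recovers the pair.\<close>
    have DS: "length Doc = b\<^sub>M" "length (Doc @ Sig) = ?L" using Bob by (auto simp: Bob_accepts_def)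
    have fwd: "length m' = ?L \<and> t\<^sub>5' = hash f (m' \<oplus>\<^sub>2 (Doc @ Sig)) \<oplus>\<^sub>2 t\<^sub>5" "m = m'"
      using recv unfolding auth_receive_shifted_key[OF DS(2) t(5)[folded lf]]
      by (simp_all only: split: if_splits) simp_all
    have untampered: "Y\<^sub>B = m\<^sub>1 \<gamma>\<^sub>B \<and> p\<^sub>B = ps \<gamma>\<^sub>B \<and> Y\<^sub>C = m\<^sub>3 \<gamma>\<^sub>C \<and> p\<^sub>C = ps \<gamma>\<^sub>C"
      if "tamper_distribution A \<omega> X\<^sub>B X\<^sub>C sent = sent"
    proof -
      have same: "c\<^sub>1' = c\<^sub>1" "t\<^sub>1' = t\<^sub>1" "c\<^sub>2' = c\<^sub>2" "t\<^sub>2' = t\<^sub>2" "c\<^sub>3' = c\<^sub>3" "t\<^sub>3' = t\<^sub>3" "c\<^sub>4' = c\<^sub>4" "t\<^sub>4' = t\<^sub>4"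
        using trans[OF tampered[symmetric] that] by (simp_all add: sent_def)
      show ?thesis
        using r secret_receive_untampered[OF lm(1) c(1) t(1)[folded lf]]
          secret_receive_untampered[OF lm(2) c(2) t(2)[folded lf]]
          secret_receive_untampered[OF lm(3) c(3) t(3)[folded lf]]
          secret_receive_untampered[OF lm(4) c(4) t(4)[folded lf]]
        by (simp add: same)
    qed
    have dec_ps: "dec (ps \<gamma>\<^sub>B) = map \<gamma>\<^sub>B [0..<n div 2]" "dec (ps \<gamma>\<^sub>C) = map \<gamma>\<^sub>C [0..<n div 2]"
      unfolding ps_def by (rule position_code_permutation(2)[OF code \<gamma>(1)])
        (rule position_code_permutation(2)[OF code \<gamma>(2)])
    show ?thesis
    proof (intro conjI impI)
      assume "tamper_distribution A \<omega> X\<^sub>B X\<^sub>C sent = sent" and m': "m' = Doc @ Sig"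
      from untampered[OF this(1)]
      have Y: "Y\<^sub>B = m\<^sub>1 \<gamma>\<^sub>B" "p\<^sub>B = ps \<gamma>\<^sub>B" "Y\<^sub>C = m\<^sub>3 \<gamma>\<^sub>C" "p\<^sub>C = ps \<gamma>\<^sub>C" by simp_all
      show "Bob_accepts n b\<^sub>M b\<^sub>H X\<^sub>B (m\<^sub>3 \<gamma>\<^sub>C) (map \<gamma>\<^sub>C [0..<n div 2]) Doc Sig"
        using Bob by (simp only: Y dec_ps)
      show "e\<^sub>m\<^sub>a\<^sub>x < Charlie_mismatches n b\<^sub>H X\<^sub>C (m\<^sub>1 \<gamma>\<^sub>B) (map \<gamma>\<^sub>B [0..<n div 2]) Doc Sig"
        using Charlie DS(1) by (simp add: Y dec_ps fwd(2) m')
    qed (use d fwd(1) DS(2) in blast)+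
  qed

  \<comment> \<open>One argument for all five transmissions: (w, u) is sent and (w', u') delivered,
    both fixed by the view. With the permutations fixed as well, the event depends on f
    alone.\<close>
  have forgery: ?thesis
    if ne: "(w', u') \<noteq> (w, u)" and u: "length u = b\<^sub>H'" and l: "l \<le> ?L"
      and E: "\<And>\<gamma>\<^sub>B \<gamma>\<^sub>C f. f \<in> axu_family b\<^sub>H' \<Longrightarrow> \<gamma>\<^sub>B permutes {..<n} \<Longrightarrow> \<gamma>\<^sub>C permutes {..<n} \<Longrightarrow>
        H \<gamma>\<^sub>B \<gamma>\<^sub>C f = Accepted_by_Bob False \<Longrightarrow>
        length w = l \<and> length w' = l \<and> u' = hash f (w' \<oplus>\<^sub>2 w) \<oplus>\<^sub>2 u" for w w' u u' l
  proof -
    have "measure_pmf.prob ?game ?rep \<le> real l / 2 ^ (b\<^sub>H' - 1)"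
      unfolding game
    proof (rule prob_bind_pmf_le, rule prob_bind_pmf_le)
      fix \<gamma>\<^sub>B \<gamma>\<^sub>C assume "\<gamma>\<^sub>B \<in> set_pmf ?perms" "\<gamma>\<^sub>C \<in> set_pmf ?perms"
      then have \<gamma>: "\<gamma>\<^sub>B permutes {..<n}" "\<gamma>\<^sub>C permutes {..<n}" by (simp_all add: set_pmf_permutations)
      show "measure_pmf.prob (?axu \<bind> (\<lambda>f. return_pmf (H \<gamma>\<^sub>B \<gamma>\<^sub>C f))) ?rep \<le> real l / 2 ^ (b\<^sub>H' - 1)"
        unfolding prob_bind_return_pmf
        by (rule prob_event_le_forgery[OF b u ne]) (use E \<gamma> in simp)
    qed
    also have "\<dots> \<le> ?forge" using l by (intro divide_right_mono of_nat_mono) auto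
    finally show ?thesis by simp
  qed

  \<comment> \<open>With \<open>pos\<close>, this makes the forwarded pair the longest message, so
    its length bounds the chance of every forgery.\<close>
  have blocks: "?l \<le> ?L"
  proof -
    have "?l \<le> n * (3 * b\<^sub>H)" unfolding blocks_length_def by (intro mult_right_mono) auto
    also have "\<dots> \<le> ?L" by simp
    finally show ?thesis .
  qed

  show ?thesis
  proof (cases "tamper_distribution A \<omega> X\<^sub>B X\<^sub>C sent = sent")
    case False
    then have "(c\<^sub>1', t\<^sub>1') \<noteq> (c\<^sub>1, t\<^sub>1) \<or> (c\<^sub>2', t\<^sub>2') \<noteq> (c\<^sub>2, t\<^sub>2) \<or> (c\<^sub>3', t\<^sub>3') \<noteq> (c\<^sub>3, t\<^sub>3) \<or> (c\<^sub>4', t\<^sub>4') \<noteq> (c\<^sub>4, t\<^sub>4)"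
      unfolding tampered unfolding sent_def by blast
    then show ?thesis
    proof (elim disjE)
      assume "(c\<^sub>1', t\<^sub>1') \<noteq> (c\<^sub>1, t\<^sub>1)"
      then show ?thesis by (rule forgery[OF _ t(1) blocks]) (use repudiated c(1) in blast)
    next
      assume "(c\<^sub>2', t\<^sub>2') \<noteq> (c\<^sub>2, t\<^sub>2)"
      then show ?thesis by (rule forgery[OF _ t(2) pos]) (use repudiated c(2) in blast)
    next
      assume "(c\<^sub>3', t\<^sub>3') \<noteq> (c\<^sub>3, t\<^sub>3)"
      then show ?thesis by (rule forgery[OF _ t(3) blocks]) (use repudiated c(3) in blast)
    next
      assume "(c\<^sub>4', t\<^sub>4') \<noteq> (c\<^sub>4, t\<^sub>4)"
      then show ?thesis by (rule forgery[OF _ t(4) pos]) (use repudiated c(4) in blast)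
    qed
  next
    case dist: True
    show ?thesis
    proof (cases "(m', t\<^sub>5') = (Doc @ Sig, t\<^sub>5)")
      case False
      then show ?thesis by (rule forgery[OF _ t(5) order.refl]) (use repudiated in blast)
    next
      case True
      \<comment> \<open>The bad signatures under Charlie's own key. This set depends on neither the
        permutations nor f.\<close>
      define M where "M = {j. j < n \<and>
        \<not> signature_ok b\<^sub>H Doc (block (2 * b\<^sub>H) (n + j) Sig) (block (3 * b\<^sub>H) j X\<^sub>C)}"
      have avoid: "e\<^sub>m\<^sub>a\<^sub>x < card M \<and> (\<forall>i<n div 2. \<gamma>\<^sub>C i \<notin> M)"
        if f: "f \<in> axu_family b\<^sub>H'" and \<gamma>: "\<gamma>\<^sub>B permutes {..<n}" "\<gamma>\<^sub>C permutes {..<n}"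
          and rep: "H \<gamma>\<^sub>B \<gamma>\<^sub>C f = Accepted_by_Bob False" for \<gamma>\<^sub>B \<gamma>\<^sub>C f
      proof -
        have Bob: "Bob_accepts n b\<^sub>M b\<^sub>H X\<^sub>B (m\<^sub>3 \<gamma>\<^sub>C) (map \<gamma>\<^sub>C [0..<n div 2]) Doc Sig"
          and Charlie: "e\<^sub>m\<^sub>a\<^sub>x < Charlie_mismatches n b\<^sub>H X\<^sub>C (m\<^sub>1 \<gamma>\<^sub>B) (map \<gamma>\<^sub>B [0..<n div 2]) Doc Sig"
          using repudiated[OF that] dist True by auto
        \<comment> \<open>Bob has verified the first n signatures with his whole key, so the blocks
          he passed on produce no mismatch and all of Charlie's mismatches lie in
          \<open>M\<close>.\<close>
        have "signature_ok b\<^sub>H Doc (block (2 * b\<^sub>H) (\<gamma>\<^sub>B i) Sig) (block (3 * b\<^sub>H) i (m\<^sub>1 \<gamma>\<^sub>B))"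
          if "i < n div 2" for i
        proof -
          have "\<gamma>\<^sub>B i < n" using permutes_in_image[OF \<gamma>(1), of i] that by auto
          then show ?thesis
            using Bob unfolding m\<^sub>1_def block_kept_blocks[OF X\<^sub>B \<gamma>(1) that] by (simp add: Bob_accepts_def)
        qed
        then have none: "{i. i < n div 2 \<and> \<not> signature_ok b\<^sub>H Doc
            (block (2 * b\<^sub>H) (map \<gamma>\<^sub>B [0..<n div 2] ! i) Sig) (block (3 * b\<^sub>H) i (m\<^sub>1 \<gamma>\<^sub>B))} = {}"
          by auto
        have "e\<^sub>m\<^sub>a\<^sub>x < card M"
          using Charlie unfolding Charlie_mismatches_def none M_def by simp
        moreover have "\<gamma>\<^sub>C i \<notin> M" if "i < n div 2" for i
        proof -
          have "signature_ok b\<^sub>H Doc (block (2 * b\<^sub>H) (n + map \<gamma>\<^sub>C [0..<n div 2] ! i) Sig) (block (3 * b\<^sub>H) i (m\<^sub>3 \<gamma>\<^sub>C))"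
            using Bob that unfolding Bob_accepts_def by blast
          then show ?thesis
            using that unfolding m\<^sub>3_def block_kept_blocks[OF X\<^sub>C \<gamma>(2) that] by (simp add: M_def)
        qed
        ultimately show ?thesis by blast
      qed
      \<comment> \<open>\<open>\<gamma>\<^sub>C\<close> is drawn last, so that it alone remains
        random.\<close>
      have swap: "?game = do { \<gamma>\<^sub>B \<leftarrow> ?perms; f \<leftarrow> ?axu; \<gamma>\<^sub>C \<leftarrow> ?perms; return_pmf (H \<gamma>\<^sub>B \<gamma>\<^sub>C f) }"
        unfolding game by (intro bind_pmf_cong refl bind_commute_pmf)
      have half: "n div 2 \<le> n" "real (n - n div 2) = real n / 2" using n by (auto elim!: evenE)
      \<comment> \<open>The second term is visibly nonnegative, which avoids discussing the sign of
        the product.\<close>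
      have guess0: "0 \<le> max ?guess ?forge" by (rule max.coboundedI2) simp
      have "measure_pmf.prob ?game ?rep \<le> max ?guess ?forge"
        unfolding swap
      proof (rule prob_bind_pmf_le, rule prob_bind_pmf_le)
        fix \<gamma>\<^sub>B f assume "\<gamma>\<^sub>B \<in> set_pmf ?perms" "f \<in> set_pmf ?axu"
        then have \<gamma>\<^sub>B: "\<gamma>\<^sub>B permutes {..<n}" and f: "f \<in> axu_family b\<^sub>H'"
          by (simp_all only: set_pmf_permutations set_pmf_axu_family[OF b] mem_Collect_eq)
        show "measure_pmf.prob (?perms \<bind> (\<lambda>\<gamma>\<^sub>C. return_pmf (H \<gamma>\<^sub>B \<gamma>\<^sub>C f))) ?rep \<le> max ?guess ?forge"
        \<comment> \<open>If \<open>M\<close> is no larger than the tolerance, no choice of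
          \<open>\<gamma>\<^sub>C\<close> leads to a repudiation.\<close>
        proof (cases "e\<^sub>m\<^sub>a\<^sub>x < card M")
          case eM: True
          have "measure_pmf.prob (?perms \<bind> (\<lambda>\<gamma>\<^sub>C. return_pmf (H \<gamma>\<^sub>B \<gamma>\<^sub>C f))) ?rep
              \<le> measure_pmf.prob ?perms {\<gamma>. \<forall>i<n div 2. \<gamma> i \<notin> M}"
            unfolding prob_bind_return_pmf
          proof (rule measure_pmf.finite_measure_mono_AE)
            show "AE \<gamma>\<^sub>C in ?perms. \<gamma>\<^sub>C \<in> {\<gamma>\<^sub>C. H \<gamma>\<^sub>B \<gamma>\<^sub>C f \<in> ?rep} \<longrightarrow> \<gamma>\<^sub>C \<in> {\<gamma>. \<forall>i<n div 2. \<gamma> i \<notin> M}"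
              unfolding AE_measure_pmf_iff set_pmf_permutations using avoid[OF f \<gamma>\<^sub>B] by blast
          qed simp
          also have "\<dots> \<le> ?guess"
            using prob_permutation_avoids[OF half(1) _ eM] unfolding half(2) by (simp add: M_def subset_eq)
          finally show ?thesis by simp
        next
          case False
          have "measure_pmf.prob (?perms \<bind> (\<lambda>\<gamma>\<^sub>C. return_pmf (H \<gamma>\<^sub>B \<gamma>\<^sub>C f))) ?rep \<le> measure_pmf.prob ?perms {}"
            unfolding prob_bind_return_pmf
          proof (rule measure_pmf.finite_measure_mono_AE)
            show "AE \<gamma>\<^sub>C in ?perms. \<gamma>\<^sub>C \<in> {\<gamma>\<^sub>C. H \<gamma>\<^sub>B \<gamma>\<^sub>C f \<in> ?rep} \<longrightarrow> \<gamma>\<^sub>C \<in> {}"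
              unfolding AE_measure_pmf_iff set_pmf_permutations using avoid[OF f \<gamma>\<^sub>B] False by blast
          qed simp
          then show ?thesis using guess0 by simp
        qed
      qed
      then show ?thesis .
    qed
  qed
qed

theorem mainTheorem7:
  fixes n e\<^sub>m\<^sub>a\<^sub>x b\<^sub>M b\<^sub>H b\<^sub>H' :: nat
    and enc :: "nat list \<Rightarrow> bits" and dec :: "bits \<Rightarrow> nat list"
    and A :: "'r alice"
  assumes "even n" and "0 < n" and "0 < b\<^sub>H" and "0 < b\<^sub>H'"
    and "position_code n enc dec"
    and "real (b\<^sub>M + 4 * n * b\<^sub>H) > real n / 2 * log 2 (real n)"
  shows "measure_pmf.prob (repudiation_game n e\<^sub>m\<^sub>a\<^sub>x b\<^sub>M b\<^sub>H b\<^sub>H' enc dec A) {Accepted_by_Bob False}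
         \<le> max (\<Prod>i = 0..e\<^sub>m\<^sub>a\<^sub>x. (real n / 2 - real i) / (real n - real i))
               (real (b\<^sub>M + 4 * n * b\<^sub>H) / 2 ^ (b\<^sub>H' - 1))"
proof -
  \<comment> \<open>\<open>positions_length\<close> rounds up, and an integer above a real number is
    at least its ceiling.\<close>
  have pos: "positions_length n \<le> b\<^sub>M + 4 * n * b\<^sub>H"
    using assms(6) unfolding positions_length_def by (simp add: ceiling_le_iff)
  \<comment> \<open>The four averages are over Alice's coins, the two keys and the view.\<close>
  show ?thesis
    unfolding repudiation_game_eq[OF assms(4,5)]
    by (rule prob_bind_pmf_le, rule prob_bind_pmf_le, rule prob_bind_pmf_le, rule prob_bind_pmf_le,
        rule prob_outcome_given_view_le[OF assms(1,2,4,5) pos]) simp_all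
qed

end
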